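(* Let $(X,d,A)$ be a metric pair with $A\neq\emptyset$ and assume that $X\setminus A$ is locally compact. Let $T:\mathrm{Lip}(X,A)\to\mathbb{R}$ be an order bounded linear functional which is exhausted by compact sets. Then there exist $\mu,\nu\in\mathcal{M}_1^+(X,A)$ such that $T(f)=\int_X f\,d(\mu-\nu)$ for all $f\in\mathrm{Lip}(X,A)$. Moreover, $\mu$ and $\nu$ can be chosen uniquely such that, for all $f\in\mathrm{Lip}^+(X,A)$, $$\inf\Bigl\{\int_X g\,d\mu+\int_X h\,d\nu\ \Big|\ g+h=f,\ g,h\in\mathrm{Lip}^+(X,A)\Bigr\}=0.$$
   Context: A metric pair $(X,d,A)$ is a metric space $(X,d)$ with a closed subset $A\subset X$; $d_A(x)=\inf_{a\in A}d(x,a)$. Measures take values in $[0,\infty]$. Let $\mathcal{B}^+(X)$ be the commutative monoid of Borel measures on $X$ and $\mathcal{B}^+(X,A)=\mathcal{B}^+(X)/\mathcal{B}^+(A)$ the quotient monoid: $\mu\sim\nu$ iff $\mu+\sigma=\nu+\tau$ for some Borel measures $\sigma,\tau$ concentrated on $A$; equivalently $\mu,\nu$ agree on Borel subsets of $X\setminus A$, so relative Borel measures correspond bijectively to Borel measures on $X\setminus A$. For $f$ vanishing on $A$, $\int_X f\,d\mu$ is well defined, and $\int f\,d(\mu-\nu)=\int f\,d\mu-\int f\,d\nu$. $\mu$ is tight if $\mu(E)=\sup\{\mu(K): K\subset E \text{ compact}\}$ for every Borel $E\subset X\setminus A$. $\mathcal{M}_1^+(X,A)$ is the set of tight $\mu\in\mathcal{B}^+(X,A)$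 with $\int d_A\,d\mu<\infty$. $\mathrm{Lip}(X,A)$ is the Riesz space (vector lattice) of Lipschitz functions $f:X\to\mathbb{R}$ with $f|_A=0$, ordered pointwise; $\mathrm{Lip}^+(X,A)$ is its set of nonnegative elements. A linear functional is order bounded if it maps order intervals to bounded sets; order bounded functionals form a Riesz space ordered by the cone of positive functionals, and $|T|=T\vee(-T)$ there. A positive linear functional $S$ on $\mathrm{Lip}(X,A)$ is exhausted by compact sets if for all $f\in\mathrm{Lip}^+(X,A)$ and $\varepsilon>0$ there is a compact $K\subset X\setminus A$ such that $\sup\{S(g): g\in\mathrm{Lip}^+(X,A),\ g|_K=0,\ g\le f\}<\varepsilon$; an order bounded $T$ is exhausted by compact sets if $|T|$ is. *)

theory Defs
  imports "HOL-Analysis.Analysis"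
begin

text \<open>The metric space \<open>X\<close> is the universe of a type of class \<open>metric_space\<close>; a metric pair is given by
  a closed set \<open>A\<close> in that type.\<close>

definition Lip :: "'a::metric_space set \<Rightarrow> ('a \<Rightarrow> real) set" where
  "Lip A = {f. (\<exists>L. L-lipschitz_on UNIV f) \<and> (\<forall>x\<in>A. f x = 0)}"

definition Lip_pos :: "'a::metric_space set \<Rightarrow> ('a \<Rightarrow> real) set" where
  "Lip_pos A = {f \<in> Lip A. \<forall>x. 0 \<le> f x}"

text \<open>A functional on \<open>Lip A\<close> is a total function on \<open>'a \<Rightarrow> real\<close> of which only the values on \<open>Lip A\<close>
  matter.\<close>

definition linear_functional :: "'a::metric_space set \<Rightarrow> (('a \<Rightarrow> real) \<Rightarrow> real) \<Rightarrow> bool" where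
  "linear_functional A T \<longleftrightarrow>
     (\<forall>f\<in>Lip A. \<forall>g\<in>Lip A. T (\<lambda>x. f x + g x) = T f + T g) \<and>
     (\<forall>c. \<forall>f\<in>Lip A. T (\<lambda>x. c * f x) = c * T f)"

definition order_bounded :: "'a::metric_space set \<Rightarrow> (('a \<Rightarrow> real) \<Rightarrow> real) \<Rightarrow> bool" where
  "order_bounded A T \<longleftrightarrow> (\<forall>f\<in>Lip A. \<forall>g\<in>Lip A. bounded (T ` {h \<in> Lip A. f \<le> h \<and> h \<le> g}))"

definition order_dual :: "'a::metric_space set \<Rightarrow> (('a \<Rightarrow> real) \<Rightarrow> real) set" where
  "order_dual A = {T. linear_functional A T \<and> order_bounded A T}"

definition positive_functional :: "'a::metric_space set \<Rightarrow> (('a \<Rightarrow> real) \<Rightarrow> real) \<Rightarrow> bool" where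
  "positive_functional A S \<longleftrightarrow> linear_functional A S \<and> (\<forall>f\<in>Lip_pos A. 0 \<le> S f)"

definition functional_le ::
    "'a::metric_space set \<Rightarrow> (('a \<Rightarrow> real) \<Rightarrow> real) \<Rightarrow> (('a \<Rightarrow> real) \<Rightarrow> real) \<Rightarrow> bool" where
  "functional_le A S T \<longleftrightarrow> positive_functional A (\<lambda>f. T f - S f)"

text \<open>\<open>is_modulus A T S\<close> says that \<open>S\<close> is the supremum of \<open>T\<close> and \<open>-T\<close> in the order dual. It determines
  \<open>S\<close> on \<open>Lip A\<close> only, which is why it is a relation.\<close>

definition is_modulus ::
    "'a::metric_space set \<Rightarrow> (('a \<Rightarrow> real) \<Rightarrow> real) \<Rightarrow> (('a \<Rightarrow> real) \<Rightarrow> real) \<Rightarrow> bool" where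
  "is_modulus A T S \<longleftrightarrow>
     S \<in> order_dual A \<and> functional_le A T S \<and> functional_le A (\<lambda>f. - T f) S \<and>
     (\<forall>R\<in>order_dual A. functional_le A T R \<and> functional_le A (\<lambda>f. - T f) R \<longrightarrow> functional_le A S R)"

definition exhausted_positive :: "'a::metric_space set \<Rightarrow> (('a \<Rightarrow> real) \<Rightarrow> real) \<Rightarrow> bool" where
  "exhausted_positive A S \<longleftrightarrow> positive_functional A S \<and>
     (\<forall>f\<in>Lip_pos A. \<forall>\<epsilon>>0. \<exists>K. compact K \<and> K \<subseteq> - A \<and>
        Sup (S ` {g \<in> Lip_pos A. (\<forall>x\<in>K. g x = 0) \<and> g \<le> f}) < \<epsilon>)"

definition exhausted_by_compacts :: "'a::metric_space set \<Rightarrow> (('a \<Rightarrow> real) \<Rightarrow> real) \<Rightarrow> bool" where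
  "exhausted_by_compacts A T \<longleftrightarrow> (\<exists>S. is_modulus A T S \<and> exhausted_positive A S)"

definition borel_measures :: "'a::metric_space measure set" where
  "borel_measures = {\<mu>. sets \<mu> = sets borel}"

text \<open>The measures on \<open>X\<close> that are concentrated on \<open>A\<close>, i.e. the image of the Borel measures on \<open>A\<close>.\<close>

definition borel_measures_on :: "'a::metric_space set \<Rightarrow> 'a measure set" where
  "borel_measures_on A = {\<sigma> \<in> borel_measures. emeasure \<sigma> (- A) = 0}"

text \<open>The library has no sum of measures, so \<open>\<mu> + \<sigma> = \<nu> + \<tau>\<close> is stated setwise.\<close>

definition relative_eq :: "'a::metric_space set \<Rightarrow> ('a measure \<times> 'a measure) set" where
  "relative_eq A = {(\<mu>, \<nu>). \<mu> \<in> borel_measures \<and> \<nu> \<in> borel_measures \<and>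
     (\<exists>\<sigma>\<in>borel_measures_on A. \<exists>\<tau>\<in>borel_measures_on A.
        \<forall>E\<in>sets borel. emeasure \<mu> E + emeasure \<sigma> E = emeasure \<nu> E + emeasure \<tau> E)}"

definition relative_borel_measures :: "'a::metric_space set \<Rightarrow> 'a measure set set" where
  "relative_borel_measures A = borel_measures // relative_eq A"

text \<open>The notions below are evaluated on a chosen representative; the lemmas at the end of the theory show
  that the choice does not matter.\<close>

definition rep_measure :: "'a measure set \<Rightarrow> 'a measure" where
  "rep_measure M = (SOME \<mu>. \<mu> \<in> M)"

definition tight :: "'a::metric_space set \<Rightarrow> 'a measure set \<Rightarrow> bool" where
  "tight A M \<longleftrightarrow> (\<forall>E\<in>sets borel. E \<subseteq> - A \<longrightarrow>
     emeasure (rep_measure M) E = (SUP K\<in>{K. compact K \<and> K \<subseteq> E}. emeasure (rep_measure M) K))"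

definition M1_pos :: "'a::metric_space set \<Rightarrow> 'a measure set set" where
  "M1_pos A = {M \<in> relative_borel_measures A.
     tight A M \<and> (\<integral>\<^sup>+x. ennreal (infdist x A) \<partial>rep_measure M) < \<infinity>}"

definition rel_integral :: "'a measure set \<Rightarrow> ('a \<Rightarrow> real) \<Rightarrow> real" where
  "rel_integral M f = (\<integral>x. f x \<partial>rep_measure M)"

lemma relative_eq_iff:
  fixes A :: "'a::metric_space set"
  assumes "closed A"
  shows "(\<mu>, \<nu>) \<in> relative_eq A \<longleftrightarrow> \<mu> \<in> borel_measures \<and> \<nu> \<in> borel_measures \<and>
    (\<forall>E\<in>sets borel. E \<subseteq> - A \<longrightarrow> emeasure \<mu> E = emeasure \<nu> E)"
proof (intro iffI conjI ballI impI)
  assume h: "(\<mu>, \<nu>) \<in> relative_eq A"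
  then show "\<mu> \<in> borel_measures" "\<nu> \<in> borel_measures" by (auto simp: relative_eq_def)
  fix E :: "'a set" assume E: "E \<in> sets borel" "E \<subseteq> - A"
  obtain \<sigma> \<tau> where st: "\<sigma> \<in> borel_measures_on A" "\<tau> \<in> borel_measures_on A"
    and eq: "\<And>E. E \<in> sets borel \<Longrightarrow> emeasure \<mu> E + emeasure \<sigma> E = emeasure \<nu> E + emeasure \<tau> E"
    using h by (auto simp: relative_eq_def)
  have z: "emeasure \<rho> E = 0" if "\<rho> \<in> borel_measures_on A" for \<rho>
  proof -
    have "emeasure \<rho> E \<le> emeasure \<rho> (- A)"
      using that E assms by (intro emeasure_mono) (auto simp: borel_measures_on_def borel_measures_def)
    then show ?thesis using that by (simp add: borel_measures_on_def)
  qed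
  show "emeasure \<mu> E = emeasure \<nu> E" using eq[OF E(1)] z[OF st(1)] z[OF st(2)] by simp
next
  assume h: "\<mu> \<in> borel_measures \<and> \<nu> \<in> borel_measures \<and>
    (\<forall>E\<in>sets borel. E \<subseteq> - A \<longrightarrow> emeasure \<mu> E = emeasure \<nu> E)"
  have A: "A \<in> sets borel" using assms by simp
  have sm: "sets \<mu> = sets borel" and sn: "sets \<nu> = sets borel"
    using h by (auto simp: borel_measures_def)
  define cut where "cut \<rho> = density \<rho> (indicator A)" for \<rho> :: "'a measure"
  have cut: "emeasure (cut \<rho>) E = emeasure \<rho> (A \<inter> E)" if "sets \<rho> = sets borel" "E \<in> sets borel" for \<rho> E
    unfolding cut_def using that A by (subst emeasure_density) (auto simp: nn_integral_indicator
        indicator_inter_arith[symmetric])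
  have cut_on: "cut \<rho> \<in> borel_measures_on A" if "sets \<rho> = sets borel" for \<rho>
    using that A cut[OF that, of "- A"]
    by (auto simp: borel_measures_on_def borel_measures_def cut_def)
  have split: "emeasure \<rho> E = emeasure \<rho> (A \<inter> E) + emeasure \<rho> (E - A)"
    if "sets \<rho> = sets borel" "E \<in> sets borel" for \<rho> E
    using that A by (subst plus_emeasure) (auto intro!: arg_cong[where f = "emeasure \<rho>"])
  have "emeasure \<mu> E + emeasure (cut \<nu>) E = emeasure \<nu> E + emeasure (cut \<mu>) E"
    if E: "E \<in> sets borel" for E
  proof -
    have "E - A \<in> sets borel" using E A by blast
    then have "emeasure \<mu> (E - A) = emeasure \<nu> (E - A)" using h by blast
    then show ?thesis
      using split[OF sm E] split[OF sn E] cut[OF sm E] cut[OF sn E] by (simp add: ac_simps)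
  qed
  then show "(\<mu>, \<nu>) \<in> relative_eq A"
    using h cut_on[OF sm] cut_on[OF sn] by (auto simp: relative_eq_def)
qed

lemma equiv_relative_eq:
  assumes "closed A"
  shows "equiv borel_measures (relative_eq A)"
  using assms by (intro equivI) (auto simp: refl_on_def sym_def trans_def relative_eq_iff)

lemma rep_measure_in:
  assumes "closed A" "M \<in> relative_borel_measures A"
  shows "rep_measure M \<in> M"
proof -
  have "M \<noteq> {}"
    using in_quotient_imp_non_empty[OF equiv_relative_eq[OF assms(1)]] assms(2)
    by (simp add: relative_borel_measures_def)
  then show ?thesis unfolding rep_measure_def by (simp add: some_in_eq)
qed

lemma related_rep_measure:
  assumes "closed A" "M \<in> relative_borel_measures A" "\<mu> \<in> M"
  shows "(\<mu>, rep_measure M) \<in> relative_eq A"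
  using in_quotient_imp_in_rel[OF equiv_relative_eq[OF assms(1)], of M \<mu> "rep_measure M"]
    assms rep_measure_in[OF assms(1,2)] by (auto simp: relative_borel_measures_def)

lemma emeasure_rep_measure:
  assumes "closed A" "M \<in> relative_borel_measures A" "\<mu> \<in> M" "E \<in> sets borel" "E \<subseteq> - A"
  shows "emeasure (rep_measure M) E = emeasure \<mu> E"
  using related_rep_measure[OF assms(1-3)] assms by (auto simp: relative_eq_iff)

lemma density_rep_measure:
  assumes "closed A" "M \<in> relative_borel_measures A" "\<mu> \<in> M"
  shows "density (rep_measure M) (indicator (- A)) = density \<mu> (indicator (- A))"
proof -
  have A: "- A \<in> sets borel" using assms by auto
  have s: "sets \<mu> = sets borel" "sets (rep_measure M) = sets borel"
    using related_rep_measure[OF assms] by (auto simp: relative_eq_def borel_measures_def)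
  have d: "emeasure (density \<rho> (indicator (- A))) E = emeasure \<rho> (- A \<inter> E)"
    if "sets \<rho> = sets borel" "E \<in> sets borel" for \<rho> :: "'a measure" and E
    using that A by (subst emeasure_density) (auto simp: nn_integral_indicator
        indicator_inter_arith[symmetric])
  show ?thesis
  proof (rule measure_eqI)
    fix E assume "E \<in> sets (density (rep_measure M) (indicator (- A)))"
    then have E: "E \<in> sets borel" using s by simp
    then have "- A \<inter> E \<in> sets borel" using A by blast
    then have "emeasure (rep_measure M) (- A \<inter> E) = emeasure \<mu> (- A \<inter> E)"
      using emeasure_rep_measure[OF assms] by blast
    then show "emeasure (density (rep_measure M) (indicator (- A))) E =
        emeasure (density \<mu> (indicator (- A))) E"
      by (simp add: d s E)
  qed (simp add: s)
qed

lemma nn_integral_rep_measure: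
  fixes f :: "'a::metric_space \<Rightarrow> ennreal"
  assumes "closed A" "M \<in> relative_borel_measures A" "\<mu> \<in> M"
    and f: "f \<in> borel_measurable borel" "\<And>x. x \<in> A \<Longrightarrow> f x = 0"
  shows "(\<integral>\<^sup>+x. f x \<partial>rep_measure M) = (\<integral>\<^sup>+x. f x \<partial>\<mu>)"
proof -
  have A: "- A \<in> sets borel" using assms by auto
  have s: "sets \<mu> = sets borel" "sets (rep_measure M) = sets borel"
    using related_rep_measure[OF assms(1-3)] by (auto simp: relative_eq_def borel_measures_def)
  have "(\<integral>\<^sup>+x. f x \<partial>\<rho>) = (\<integral>\<^sup>+x. f x \<partial>density \<rho> (indicator (- A)))"
    if r: "sets \<rho> = sets borel" for \<rho> :: "'a measure"
  proof -
    have m: "f \<in> borel_measurable \<rho>" "indicator (- A) \<in> borel_measurable \<rho>"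
      using f(1) A r measurable_cong_sets[OF r refl] by auto
    show ?thesis
      by (subst nn_integral_density[OF m(2,1)])
         (auto intro!: nn_integral_cong simp: f(2) split: split_indicator)
  qed
  then show ?thesis using density_rep_measure[OF assms(1-3)] s by metis
qed

lemma rel_integral_eq:
  fixes f :: "'a::metric_space \<Rightarrow> real"
  assumes "closed A" "M \<in> relative_borel_measures A" "\<mu> \<in> M"
    and f: "f \<in> borel_measurable borel" "\<And>x. x \<in> A \<Longrightarrow> f x = 0"
  shows "rel_integral M f = (\<integral>x. f x \<partial>\<mu>)"
proof -
  have A: "- A \<in> sets borel" using assms by auto
  have s: "sets \<mu> = sets borel" "sets (rep_measure M) = sets borel"
    using related_rep_measure[OF assms(1-3)] by (auto simp: relative_eq_def borel_measures_def)
  have "(\<integral>x. f x \<partial>\<rho>) = (\<integral>x. f x \<partial>density \<rho> (indicator (- A)))"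
    if r: "sets \<rho> = sets borel" for \<rho> :: "'a measure"
  proof -
    have m: "f \<in> borel_measurable \<rho>" "(indicator (- A) :: 'a \<Rightarrow> real) \<in> borel_measurable \<rho>"
      using f(1) A r measurable_cong_sets[OF r refl] by auto
    have "(\<integral>x. f x \<partial>density \<rho> (\<lambda>x. ennreal (indicator (- A) x))) = (\<integral>x. indicator (- A) x *\<^sub>R f x \<partial>\<rho>)"
      by (rule integral_density) (use m in auto)
    also have "\<dots> = (\<integral>x. f x \<partial>\<rho>)"
      by (rule Bochner_Integration.integral_cong) (auto simp: f(2) split: split_indicator)
    finally show ?thesis by (simp add: ennreal_indicator)
  qed
  then show ?thesis using density_rep_measure[OF assms(1-3)] s unfolding rel_integral_def by metis
qed

end

theory Submission
  imports Defs
begin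

text \<open>Let \<open>S\<close> be the modulus of \<open>T\<close>. The functionals \<open>P = (S + T) / 2\<close> and \<open>N = (S - T) / 2\<close> are
  positive and dominated by \<open>S\<close>, hence exhausted by compact sets. By a Dini argument a positive
  functional exhausted by compact sets is continuous along sequences that decrease pointwise to \<open>0\<close>.
  The supremum of its values on Lipschitz functions below the indicator of an open set then induces an
  outer measure, whose restriction to the Borel sets represents the functional and is tight.
  The Riesz--Kantorovich formula for \<open>S\<close> shows that \<open>P\<close> and \<open>N\<close> are disjoint. For uniqueness, if
  \<open>P - N = P' - N'\<close> with \<open>P\<close>, \<open>N\<close> disjoint, a splitting \<open>f = g + h\<close> with \<open>P g + N h\<close> small gives
  \<open>P f \<le> P' f\<close> up to a small error, and tight measures are determined by their values on compact
  sets, whose indicators are dominated limits of Lipschitz functions.\<close>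

section \<open>The lattice of Lipschitz functions\<close>

text \<open>\<open>Lip A\<close> contains no nonzero constant, and the representing measure may have
  infinite mass near \<open>A\<close>, because only the distance to \<open>A\<close> has to be
  integrable. Constants are replaced by two devices: closure under \<open>min\<close> with a
  constant \<open>c \<ge> 0\<close>, which keeps horizontal slices of a function inside the lattice,
  and multiples of \<open>infdist\<close>, which dominate 1 on sets that stay away from
  \<open>A\<close>. Functions may also be unbounded, so \<open>P\<close> and the integral are
  compared between a positive and a finite level, and the rest is recovered by limits. Exhaustion
  enters twice: it turns uniform smallness on a compact set into smallness of \<open>P\<close>, the
  source of countable subadditivity, and it bounds the mass left outside a compact set, the source
  of tightness. The modulus is known only by its universal property, so its values must be compared
  with a supremum built by hand before disjointness can be read off.\<close>

lemma LipI:
  assumes "\<And>x y. \<bar>f x - f y\<bar> \<le> L * dist x y" "\<And>x. x \<in> A \<Longrightarrow> f x = 0"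
  shows "f \<in> Lip A"
proof -
  have "(max L 0)-lipschitz_on UNIV f"
  proof (rule lipschitz_onI)
    fix x y
    show "dist (f x) (f y) \<le> max L 0 * dist x y"
      using assms(1)[of x y] mult_right_mono[of L "max L 0" "dist x y"] by (simp add: dist_real_def)
  qed simp
  then show ?thesis using assms(2) by (auto simp: Lip_def)
qed

lemma LipE:
  assumes "f \<in> Lip A"
  obtains L where "0 \<le> L" "\<And>x y. \<bar>f x - f y\<bar> \<le> L * dist x y" "\<And>x. x \<in> A \<Longrightarrow> f x = 0"
  using assms unfolding Lip_def
  by (auto simp: lipschitz_on_def dist_real_def)

lemma Lip_eq_0: "f \<in> Lip A \<Longrightarrow> x \<in> A \<Longrightarrow> f x = 0"
  by (simp add: Lip_def)

lemma Lip_zero [simp]: "(\<lambda>x. 0) \<in> Lip A"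
  by (rule LipI[of _ 0]) auto

lemma Lip_add:
  assumes "f \<in> Lip A" "g \<in> Lip A"
  shows "(\<lambda>x. f x + g x) \<in> Lip A"
proof -
  from assms obtain L M where
    L: "\<And>x y. \<bar>f x - f y\<bar> \<le> L * dist x y" and M: "\<And>x y. \<bar>g x - g y\<bar> \<le> M * dist x y"
    by (metis LipE)
  show ?thesis
  proof (rule LipI[of _ "L + M"])
    fix x y
    show "\<bar>f x + g x - (f y + g y)\<bar> \<le> (L + M) * dist x y"
      using L[of x y] M[of x y] unfolding distrib_right by linarith
  qed (use assms in \<open>simp add: Lip_eq_0\<close>)
qed

lemma Lip_cmult:
  assumes "f \<in> Lip A"
  shows "(\<lambda>x. c * f x) \<in> Lip A"
proof -
  from assms obtain L where L: "\<And>x y. \<bar>f x - f y\<bar> \<le> L * dist x y"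
    by (metis LipE)
  show ?thesis
  proof (rule LipI[of _ "\<bar>c\<bar> * L"])
    fix x y
    show "\<bar>c * f x - c * f y\<bar> \<le> \<bar>c\<bar> * L * dist x y"
      using mult_left_mono[OF L[of x y], of "\<bar>c\<bar>"]
      by (simp add: abs_mult[symmetric] right_diff_distrib mult.assoc)
  qed (use assms in \<open>simp add: Lip_eq_0\<close>)
qed

lemma Lip_uminus: "f \<in> Lip A \<Longrightarrow> (\<lambda>x. - f x) \<in> Lip A"
  using Lip_cmult[of f A "-1"] by simp

lemma Lip_diff: "f \<in> Lip A \<Longrightarrow> g \<in> Lip A \<Longrightarrow> (\<lambda>x. f x - g x) \<in> Lip A"
  using Lip_add[OF _ Lip_uminus, of f A g] by simp

lemma Lip_max:
  assumes "f \<in> Lip A" "g \<in> Lip A"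
  shows "(\<lambda>x. max (f x) (g x)) \<in> Lip A"
proof -
  from assms obtain L M where
    L: "\<And>x y. \<bar>f x - f y\<bar> \<le> L * dist x y" and M: "\<And>x y. \<bar>g x - g y\<bar> \<le> M * dist x y"
    by (metis LipE)
  show ?thesis
  proof (rule LipI[of _ "max L M"])
    fix x y :: 'a
    have "L * dist x y \<le> max L M * dist x y" "M * dist x y \<le> max L M * dist x y"
      by (auto intro: mult_right_mono)
    then show "\<bar>max (f x) (g x) - max (f y) (g y)\<bar> \<le> max L M * dist x y"
      using L[of x y] M[of x y] by (simp add: max_def abs_le_iff split: if_splits)
  qed (use assms in \<open>simp add: Lip_eq_0\<close>)
qed

lemma Lip_min:
  assumes "f \<in> Lip A" "g \<in> Lip A"
  shows "(\<lambda>x. min (f x) (g x)) \<in> Lip A"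
proof -
  have "(\<lambda>x. min (f x) (g x)) = (\<lambda>x. - max (- f x) (- g x))" by (auto simp: min_def max_def)
  then show ?thesis using assms by (simp add: Lip_uminus Lip_max)
qed

lemma Lip_min_const:
  assumes "f \<in> Lip A" "0 \<le> c"
  shows "(\<lambda>x. min (f x) c) \<in> Lip A"
proof -
  from assms obtain L where L: "0 \<le> L" "\<And>x y. \<bar>f x - f y\<bar> \<le> L * dist x y"
    by (metis LipE)
  show ?thesis
  proof (rule LipI[of _ L])
    fix x y
    show "\<bar>min (f x) c - min (f y) c\<bar> \<le> L * dist x y"
      using L(2)[of x y] by (simp add: min_def abs_le_iff split: if_splits)
  qed (use assms in \<open>simp add: Lip_eq_0\<close>)
qed

lemma Lip_infdist:
  assumes "A \<subseteq> B"
  shows "(\<lambda>x. infdist x B) \<in> Lip A"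
  using assms infdist_triangle_abs by (intro LipI[of _ 1]) auto

lemma Lip_posI: "f \<in> Lip A \<Longrightarrow> (\<And>x. 0 \<le> f x) \<Longrightarrow> f \<in> Lip_pos A"
  by (simp add: Lip_pos_def)

lemma Lip_posD: "f \<in> Lip_pos A \<Longrightarrow> f \<in> Lip A" "f \<in> Lip_pos A \<Longrightarrow> 0 \<le> f x"
  by (auto simp: Lip_pos_def)

lemma Lip_pos_zero [simp]: "(\<lambda>x. 0) \<in> Lip_pos A"
  by (simp add: Lip_pos_def)

lemma Lip_pos_add: "f \<in> Lip_pos A \<Longrightarrow> g \<in> Lip_pos A \<Longrightarrow> (\<lambda>x. f x + g x) \<in> Lip_pos A"
  by (simp add: Lip_pos_def Lip_add)

lemma Lip_pos_cmult: "f \<in> Lip_pos A \<Longrightarrow> 0 \<le> c \<Longrightarrow> (\<lambda>x. c * f x) \<in> Lip_pos A"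
  by (simp add: Lip_pos_def Lip_cmult)

lemma Lip_pos_part: "f \<in> Lip A \<Longrightarrow> (\<lambda>x. max (f x) 0) \<in> Lip_pos A"
  by (simp add: Lip_pos_def Lip_max)

lemma Lip_pos_min_const: "f \<in> Lip_pos A \<Longrightarrow> 0 \<le> c \<Longrightarrow> (\<lambda>x. min (f x) c) \<in> Lip_pos A"
  by (simp add: Lip_pos_def Lip_min_const)

lemma Lip_pos_diff: "f \<in> Lip A \<Longrightarrow> g \<in> Lip A \<Longrightarrow> (\<And>x. g x \<le> f x) \<Longrightarrow> (\<lambda>x. f x - g x) \<in> Lip_pos A"
  by (simp add: Lip_pos_def Lip_diff)

lemma Lip_continuous:
  assumes "f \<in> Lip A"
  shows "continuous_on UNIV f"
  using assms by (auto simp: Lip_def intro: lipschitz_on_continuous_on)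

lemma Lip_measurable: "f \<in> Lip A \<Longrightarrow> f \<in> borel_measurable borel"
  by (intro borel_measurable_continuous_onI Lip_continuous)

text \<open>The Lipschitz estimate against a point \<open>a\<close> of \<open>A\<close>, where
  \<open>f\<close> vanishes, gives the bound \<open>L * dist x a\<close>; then take the infimum over
  \<open>a\<close>. It makes every element of \<open>Lip A\<close> integrable once the distance to
  \<open>A\<close> is.\<close>

lemma Lip_le_infdist:
  assumes "f \<in> Lip A" "A \<noteq> {}"
  obtains L where "0 \<le> L" "\<And>x. \<bar>f x\<bar> \<le> L * infdist x A"
proof -
  from assms obtain L where L: "0 \<le> L" "\<And>x y. \<bar>f x - f y\<bar> \<le> L * dist x y"
    "\<And>x. x \<in> A \<Longrightarrow> f x = 0" by (metis LipE)
  have "\<bar>f x\<bar> \<le> L * infdist x A" for x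
  proof (cases "L = 0")
    case True
    obtain a where "a \<in> A" using assms(2) by blast
    then show ?thesis using True L(2)[of x a] L(3) by simp
  next
    case False
    then have "0 < L" using L(1) by simp
    have "\<bar>f x\<bar> / L \<le> dist x a" if "a \<in> A" for a
      using L(2)[of x a] L(3)[OF that] \<open>0 < L\<close> by (simp add: divide_le_eq mult.commute)
    then have "\<bar>f x\<bar> / L \<le> infdist x A"
      unfolding infdist_notempty[OF assms(2)] using assms(2) by (intro cINF_greatest)
    then show ?thesis using \<open>0 < L\<close> by (simp add: divide_le_eq mult.commute)
  qed
  then show ?thesis using L(1) that by blast
qed

section \<open>Functionals and the Riesz--Kantorovich formula\<close>

lemma linear_functional_add:
  "linear_functional A T \<Longrightarrow> f \<in> Lip A \<Longrightarrow> g \<in> Lip A \<Longrightarrow> T (\<lambda>x. f x + g x) = T f + T g"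
  by (simp add: linear_functional_def)

lemma linear_functional_cmult:
  "linear_functional A T \<Longrightarrow> f \<in> Lip A \<Longrightarrow> T (\<lambda>x. c * f x) = c * T f"
  by (simp add: linear_functional_def)

lemma linear_functional_zero: "linear_functional A T \<Longrightarrow> T (\<lambda>x. 0) = 0"
  using linear_functional_cmult[of A T "\<lambda>x. 0" 0] by simp

lemma linear_functional_uminus:
  "linear_functional A T \<Longrightarrow> f \<in> Lip A \<Longrightarrow> T (\<lambda>x. - f x) = - T f"
  using linear_functional_cmult[of A T f "-1"] by simp

lemma linear_functional_diff:
  "linear_functional A T \<Longrightarrow> f \<in> Lip A \<Longrightarrow> g \<in> Lip A \<Longrightarrow> T (\<lambda>x. f x - g x) = T f - T g"
  using linear_functional_add[of A T f "\<lambda>x. - g x"] by (simp add: linear_functional_uminus Lip_uminus)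

lemma positive_functional_mono:
  assumes "positive_functional A P" "f \<in> Lip A" "g \<in> Lip A" "\<And>x. f x \<le> g x"
  shows "P f \<le> P g"
proof -
  have "0 \<le> P (\<lambda>x. g x - f x)"
    using assms by (simp add: positive_functional_def Lip_pos_diff)
  then show ?thesis
    using assms linear_functional_diff[of A P g f] by (simp add: positive_functional_def)
qed

lemma positive_functional_order_dual:
  assumes "positive_functional A P"
  shows "P \<in> order_dual A"
proof -
  have "bounded (P ` {h \<in> Lip A. f \<le> h \<and> h \<le> g})" if "f \<in> Lip A" "g \<in> Lip A" for f g
  proof (rule bounded_subset[OF bounded_closed_interval[of "P f" "P g"]])
    show "P ` {h \<in> Lip A. f \<le> h \<and> h \<le> g} \<subseteq> {P f..P g}"
      using that positive_functional_mono[OF assms] by (auto simp: le_fun_def)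
  qed
  then show ?thesis
    using assms by (simp add: order_dual_def order_bounded_def positive_functional_def)
qed

text \<open>Kantorovich's extension from the cone. The value \<open>R u - R v\<close> is the same
  for every decomposition \<open>f = u - v\<close>, because the positive part of \<open>f\<close>
  plus \<open>v\<close> equals the negative part plus \<open>u\<close>; linearity then follows by
  choosing convenient decompositions.\<close>

lemma positive_functional_extension:
  assumes add: "\<And>f g. f \<in> Lip_pos A \<Longrightarrow> g \<in> Lip_pos A \<Longrightarrow> R (\<lambda>x. f x + g x) = R f + R g"
    and cmult: "\<And>c f. 0 \<le> c \<Longrightarrow> f \<in> Lip_pos A \<Longrightarrow> R (\<lambda>x. c * f x) = c * R f"
    and nonneg: "\<And>f. f \<in> Lip_pos A \<Longrightarrow> 0 \<le> R f"
  obtains Q where "positive_functional A Q" "\<And>f. f \<in> Lip_pos A \<Longrightarrow> Q f = R f"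
proof -
  define Q where "Q f = R (\<lambda>x. max (f x) 0) - R (\<lambda>x. max (- f x) 0)" for f
  have Q: "Q f = R u - R v" if "f \<in> Lip A" "u \<in> Lip_pos A" "v \<in> Lip_pos A" "\<And>x. f x = u x - v x" for f u v
  proof -
    have "R (\<lambda>x. max (f x) 0 + v x) = R (\<lambda>x. max (- f x) 0 + u x)"
      by (rule arg_cong[of _ _ R]) (auto simp: that(4) max_def)
    moreover have "R (\<lambda>x. max (f x) 0 + v x) = R (\<lambda>x. max (f x) 0) + R v"
      by (rule add[OF Lip_pos_part[OF that(1)] that(3)])
    moreover have "R (\<lambda>x. max (- f x) 0 + u x) = R (\<lambda>x. max (- f x) 0) + R u"
      by (rule add[OF Lip_pos_part[OF Lip_uminus[OF that(1)]] that(2)])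
    ultimately show ?thesis by (simp add: Q_def)
  qed
  have R0: "R (\<lambda>x. 0) = 0" using cmult[of 0 "\<lambda>x. 0"] by simp
  have QR: "Q f = R f" if "f \<in> Lip_pos A" for f
    using Q[of f f "\<lambda>x. 0"] that R0 by (simp add: Lip_posD)
  have "linear_functional A Q"
    unfolding linear_functional_def
  proof (intro conjI ballI allI)
    fix f g assume fg: "f \<in> Lip A" "g \<in> Lip A"
    let ?u = "\<lambda>x. max (f x) 0 + max (g x) 0" and ?v = "\<lambda>x. max (- f x) 0 + max (- g x) 0"
    have "Q (\<lambda>x. f x + g x) = R ?u - R ?v"
      using fg by (intro Q Lip_add Lip_pos_add Lip_pos_part Lip_uminus) (auto simp: max_def)
    also have "R ?u = R (\<lambda>x. max (f x) 0) + R (\<lambda>x. max (g x) 0)"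
      using fg by (intro add Lip_pos_part)
    also have "R ?v = R (\<lambda>x. max (- f x) 0) + R (\<lambda>x. max (- g x) 0)"
      using fg by (intro add Lip_pos_part Lip_uminus)
    finally show "Q (\<lambda>x. f x + g x) = Q f + Q g" by (simp add: Q_def)
  next
    fix c f assume f: "f \<in> Lip A"
    show "Q (\<lambda>x. c * f x) = c * Q f"
    proof (cases "0 \<le> c")
      case True
      have "Q (\<lambda>x. c * f x) = R (\<lambda>x. c * max (f x) 0) - R (\<lambda>x. c * max (- f x) 0)"
        using f True by (intro Q Lip_cmult Lip_pos_cmult Lip_pos_part Lip_uminus) (auto simp: max_def)
      also have "\<dots> = c * R (\<lambda>x. max (f x) 0) - c * R (\<lambda>x. max (- f x) 0)"
        using f True by (intro arg_cong2[of _ _ _ _ minus] cmult Lip_pos_part Lip_uminus) auto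
      finally show ?thesis by (simp add: Q_def algebra_simps)
    next
      case False
      have "Q (\<lambda>x. c * f x) = R (\<lambda>x. (- c) * max (- f x) 0) - R (\<lambda>x. (- c) * max (f x) 0)"
        using f False by (intro Q Lip_cmult Lip_pos_cmult Lip_pos_part Lip_uminus) (auto simp: max_def)
      also have "\<dots> = (- c) * R (\<lambda>x. max (- f x) 0) - (- c) * R (\<lambda>x. max (f x) 0)"
        using f False by (intro arg_cong2[of _ _ _ _ minus] cmult Lip_pos_part Lip_uminus) auto
      finally show ?thesis by (simp add: Q_def algebra_simps)
    qed
  qed
  then have "positive_functional A Q"
    using nonneg by (simp add: positive_functional_def QR)
  then show ?thesis using QR that by blast
qed

text \<open>The supremum \<open>R f\<close> of \<open>T g\<close> over all \<open>g\<close> with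
  \<open>\<bar>g\<bar> \<le> f\<close> is additive on the cone and extends to an upper bound of
  \<open>T\<close> and \<open>- T\<close> in the order dual. Minimality of the modulus gives
  \<open>S f \<le> R f\<close>, the only half of the Riesz--Kantorovich formula that is
  used.\<close>

lemma modulus_approx:
  assumes T: "linear_functional A T" "order_bounded A T" and S: "is_modulus A T S"
    and f: "f \<in> Lip_pos A" and e: "0 < e"
  obtains g where "g \<in> Lip A" "\<And>x. \<bar>g x\<bar> \<le> f x" "S f - e < T g"
proof -
  define D where "D f = {g \<in> Lip A. \<forall>x. \<bar>g x\<bar> \<le> f x}" for f
  define R where "R f = (SUP g\<in>D f. T g)" for f
  have bdd: "bdd_above (T ` D f)" if "f \<in> Lip_pos A" for f
  proof -
    have "D f = {h \<in> Lip A. (\<lambda>x. - f x) \<le> h \<and> h \<le> f}"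
      by (auto simp: D_def le_fun_def abs_le_iff minus_le_iff)
    moreover have "bounded (T ` {h \<in> Lip A. (\<lambda>x. - f x) \<le> h \<and> h \<le> f})"
      using T(2) Lip_posD(1)[OF that] Lip_uminus[OF Lip_posD(1)[OF that]]
      unfolding order_bounded_def by blast
    ultimately show ?thesis by (simp add: bounded_imp_bdd_above)
  qed
  have D0: "(\<lambda>x. 0) \<in> D f" if "f \<in> Lip_pos A" for f
    using that by (simp add: D_def Lip_posD)
  then have ne: "D f \<noteq> {}" if "f \<in> Lip_pos A" for f using that by auto
  have TR: "T g \<le> R f" if "f \<in> Lip_pos A" "g \<in> D f" for f g
    unfolding R_def using that bdd by (intro cSUP_upper)
  have Rle: "R f \<le> c" if "f \<in> Lip_pos A" "\<And>g. g \<in> D f \<Longrightarrow> T g \<le> c" for f c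
    unfolding R_def using that ne by (intro cSUP_least)
  have nonneg: "0 \<le> R f" if "f \<in> Lip_pos A" for f
    using TR[OF that D0[OF that]] linear_functional_zero[OF T(1)] by simp
  have add: "R (\<lambda>x. f x + g x) = R f + R g" if fg: "f \<in> Lip_pos A" "g \<in> Lip_pos A" for f g
  proof (rule antisym)
    show "R (\<lambda>x. f x + g x) \<le> R f + R g"
    proof (rule Rle[OF Lip_pos_add[OF fg]])
      fix h assume h: "h \<in> D (\<lambda>x. f x + g x)"
      \<comment> \<open>Riesz decomposition: \<open>u\<close> truncates \<open>h\<close> to the
        interval from \<open>- f\<close> to \<open>f\<close>, and the overshoot \<open>h - u\<close>
        is bounded by \<open>g\<close>.\<close>
      define u where "u x = max (- f x) (min (h x) (f x))" for x
      have [simp]: "u \<in> Lip A" "h \<in> Lip A"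
        using h fg unfolding u_def[abs_def] D_def by (auto intro!: Lip_max Lip_min Lip_uminus dest: Lip_posD)
      have "u \<in> D f" using Lip_posD(2)[OF fg(1)] by (auto simp: D_def u_def abs_le_iff max_def min_def)
      moreover have "(\<lambda>x. h x - u x) \<in> D g"
        unfolding D_def
      proof (intro CollectI conjI allI Lip_diff)
        fix x
        have "\<bar>h x\<bar> \<le> f x + g x" using h by (simp add: D_def)
        then show "\<bar>h x - u x\<bar> \<le> g x"
          using Lip_posD(2)[OF fg(2), of x] Lip_posD(2)[OF fg(1), of x]
          by (auto simp: u_def abs_le_iff max_def min_def)
      qed simp_all
      ultimately have "T u + T (\<lambda>x. h x - u x) \<le> R f + R g"
        using fg by (intro add_mono TR)
      then show "T h \<le> R f + R g"
        using linear_functional_diff[OF T(1), of h u] by simp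
    qed
    have "T u + T v \<le> R (\<lambda>x. f x + g x)" if "u \<in> D f" "v \<in> D g" for u v
    proof -
      have "\<bar>u x + v x\<bar> \<le> f x + g x" for x
        using that abs_triangle_ineq[of "u x" "v x"] by (simp add: D_def) (meson add_mono order_trans)
      then have "(\<lambda>x. u x + v x) \<in> D (\<lambda>x. f x + g x)"
        using that by (auto simp: D_def intro: Lip_add)
      then have "T (\<lambda>x. u x + v x) \<le> R (\<lambda>x. f x + g x)" by (rule TR[OF Lip_pos_add[OF fg]])
      then show ?thesis
        using linear_functional_add[OF T(1), of u v] that by (auto simp: D_def)
    qed
    then have "T u \<le> R (\<lambda>x. f x + g x) - T v" if "u \<in> D f" "v \<in> D g" for u v
      using that by (simp add: le_diff_eq)
    then have "R f \<le> R (\<lambda>x. f x + g x) - T v" if "v \<in> D g" for v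
      using that by (intro Rle[OF fg(1)])
    then have "T v \<le> R (\<lambda>x. f x + g x) - R f" if "v \<in> D g" for v
      using that by (simp add: le_diff_eq add.commute)
    then have "R g \<le> R (\<lambda>x. f x + g x) - R f"
      by (rule Rle[OF fg(2)])
    then show "R f + R g \<le> R (\<lambda>x. f x + g x)" by simp
  qed
  have cle: "c * R f \<le> R (\<lambda>x. c * f x)" if "0 \<le> c" "f \<in> Lip_pos A" for c f
  proof (cases "c = 0")
    case True
    then show ?thesis using nonneg[of "\<lambda>x. 0"] by simp
  next
    case False
    have "R f \<le> R (\<lambda>x. c * f x) / c"
    proof (rule Rle[OF that(2)])
      fix g assume g: "g \<in> D f"
      then have "(\<lambda>x. c * g x) \<in> D (\<lambda>x. c * f x)"
        using that by (auto simp: D_def abs_mult intro!: Lip_cmult mult_left_mono)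
      then have "T (\<lambda>x. c * g x) \<le> R (\<lambda>x. c * f x)" using that by (intro TR Lip_pos_cmult)
      then show "T g \<le> R (\<lambda>x. c * f x) / c"
        using False that g linear_functional_cmult[OF T(1), of g c]
        by (simp add: D_def le_divide_eq mult.commute)
    qed
    then show ?thesis using False that by (simp add: le_divide_eq mult.commute)
  qed
  have cmult: "R (\<lambda>x. c * f x) = c * R f" if "0 \<le> c" "f \<in> Lip_pos A" for c f
  proof (cases "c = 0")
    case True
    have "T g \<le> 0" if "g \<in> D (\<lambda>x. 0)" for g
    proof -
      have "g = (\<lambda>x. 0)" using that by (auto simp: D_def)
      then show ?thesis using linear_functional_zero[OF T(1)] by simp
    qed
    then have "R (\<lambda>x. 0) \<le> 0" by (intro Rle) auto
    then show ?thesis using True nonneg[of "\<lambda>x. 0"] by simp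
  next
    case False
    \<comment> \<open>The inequality \<open>cle\<close> for the factor \<open>inverse c\<close>,
      applied to \<open>c * f\<close>, yields the reverse estimate.\<close>
    have "inverse c * R (\<lambda>x. c * f x) \<le> R (\<lambda>x. inverse c * (c * f x))"
      using that by (intro cle Lip_pos_cmult) auto
    then have "inverse c * R (\<lambda>x. c * f x) \<le> R f"
      using False by (simp add: mult.assoc[symmetric])
    then have "R (\<lambda>x. c * f x) \<le> c * R f"
      using False that by (simp add: field_simps)
    then show ?thesis using cle[OF that] by simp
  qed
  \<comment> \<open>Minimality of \<open>S\<close> can be tested only against members of the order
    dual, and \<open>R\<close> is linear only on the cone; hence the passage to
    \<open>Q\<close>.\<close>
  obtain Q where Q: "positive_functional A Q" "\<And>f. f \<in> Lip_pos A \<Longrightarrow> Q f = R f"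
    using positive_functional_extension[of A R, OF add cmult nonneg] by blast
  have lin: "linear_functional A (\<lambda>f. Q f - c * T f)" for c
    using Q(1) T(1) by (auto simp: positive_functional_def linear_functional_def algebra_simps)
  have "0 \<le> Q f - T f \<and> 0 \<le> Q f - - T f" if "f \<in> Lip_pos A" for f
  proof -
    have "f \<in> D f" "(\<lambda>x. - f x) \<in> D f" using that by (auto simp: D_def Lip_posD intro: Lip_uminus)
    then show ?thesis
      using TR[OF that] Q(2)[OF that] linear_functional_uminus[OF T(1), of f] Lip_posD(1)[OF that] by fastforce
  qed
  then have "functional_le A T Q" "functional_le A (\<lambda>f. - T f) Q"
    using lin[of 1] lin[of "-1"] unfolding functional_le_def positive_functional_def
    by simp_all
  then have "functional_le A S Q"
    using S positive_functional_order_dual[OF Q(1)] unfolding is_modulus_def by blast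
  then have "0 \<le> Q f - S f"
    using f unfolding functional_le_def positive_functional_def by blast
  then have "S f \<le> R f" using Q(2)[OF f] by simp
  then have "S f - e < R f" using e by simp
  then obtain g where "g \<in> D f" "S f - e < T g"
    unfolding R_def using less_cSUP_iff[OF ne[OF f] bdd[OF f]] by blast
  then show ?thesis using that by (auto simp: D_def)
qed

text \<open>The distance to \<open>A\<close> attains a positive minimum on \<open>K\<close>, and
  dividing \<open>infdist\<close> by it gives a substitute for the constant 1.\<close>

lemma compact_dominated:
  assumes "closed A" "A \<noteq> {}" "compact K" "K \<subseteq> - A"
  obtains \<phi> where "\<phi> \<in> Lip_pos A" "\<And>x. x \<in> K \<Longrightarrow> 1 \<le> \<phi> x"
proof (cases "K = {}")
  case True
  then show ?thesis using that[of "\<lambda>x. 0"] by simp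
next
  case False
  have "continuous_on K (\<lambda>x. infdist x A)" by (intro continuous_intros)
  then obtain z where z: "z \<in> K" "\<And>x. x \<in> K \<Longrightarrow> infdist z A \<le> infdist x A"
    using continuous_attains_inf[OF assms(3) False] by blast
  have r: "0 < infdist z A"
    using z(1) assms by (intro infdist_pos_not_in_closed) auto
  show ?thesis
  proof (rule that)
    show "(\<lambda>x. inverse (infdist z A) * infdist x A) \<in> Lip_pos A"
      by (intro Lip_posI Lip_cmult Lip_infdist) (auto simp: infdist_nonneg)
    show "1 \<le> inverse (infdist z A) * infdist x A" if "x \<in> K" for x
      using z(2)[OF that] r by (simp add: field_simps)
  qed
qed

lemma Lip_pos_sum:
  fixes f :: "nat \<Rightarrow> 'a::metric_space \<Rightarrow> real"
  assumes "\<And>i. f i \<in> Lip_pos A"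
  shows "(\<lambda>x. \<Sum>i<n. f i x) \<in> Lip_pos A"
  by (induction n) (auto intro: Lip_pos_add assms)

lemma linear_functional_sum:
  fixes f :: "nat \<Rightarrow> 'a::metric_space \<Rightarrow> real"
  assumes T: "linear_functional A T" and f: "\<And>i. f i \<in> Lip_pos A"
  shows "T (\<lambda>x. \<Sum>i<n. f i x) = (\<Sum>i<n. T (f i))"
proof (induction n)
  case 0
  then show ?case by (simp add: linear_functional_zero[OF T])
next
  case (Suc n)
  then show ?case
    using linear_functional_add[OF T Lip_posD(1)[OF Lip_pos_sum[of f A n, OF f]] Lip_posD(1)[OF f, of n]] by simp
qed

section \<open>The measure of a functional exhausted by compact sets\<close>

text \<open>Exhaustion is stated by a bound on each single \<open>g\<close> instead of a supremum,
  so that it passes at once to smaller positive functionals and needs no boundedness side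
  condition.\<close>

locale exhausted_functional =
  fixes A :: "'a::metric_space set" and P :: "('a \<Rightarrow> real) \<Rightarrow> real"
  assumes closed: "closed A" and nonempty: "A \<noteq> {}"
    and positive: "positive_functional A P"
    and exhausted: "\<And>f \<epsilon>. f \<in> Lip_pos A \<Longrightarrow> 0 < \<epsilon> \<Longrightarrow> \<exists>K. compact K \<and> K \<subseteq> - A \<and>
      (\<forall>g\<in>Lip_pos A. (\<forall>x\<in>K. g x = 0) \<longrightarrow> (\<forall>x. g x \<le> f x) \<longrightarrow> P g \<le> \<epsilon>)"
begin

lemma linear: "linear_functional A P"
  using positive by (simp add: positive_functional_def)

lemma nonneg: "f \<in> Lip_pos A \<Longrightarrow> 0 \<le> P f"
  using positive by (simp add: positive_functional_def)

lemmas mono = positive_functional_mono[OF positive]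
lemmas add = linear_functional_add[OF linear]
lemmas diff = linear_functional_diff[OF linear]
lemmas cmult = linear_functional_cmult[OF linear]

section \<open>Monotone continuity of the functional\<close>

lemma tendsto_0_decreasing:
  assumes f: "\<And>n. f n \<in> Lip_pos A" and dec: "\<And>n x. f (Suc n) x \<le> f n x"
    and lim: "\<And>x. (\<lambda>n. f n x) \<longlonglongrightarrow> 0"
  shows "(\<lambda>n. P (f n)) \<longlonglongrightarrow> 0"
proof (rule LIMSEQ_I)
  fix e :: real assume e: "0 < e"
  have le: "f m x \<le> f n x" if "n \<le> m" for m n x
    using dec that by (rule lift_Suc_antimono_le)
  obtain K where K: "compact K" "K \<subseteq> - A"
    and small: "\<And>g. g \<in> Lip_pos A \<Longrightarrow> (\<And>x. x \<in> K \<Longrightarrow> g x = 0) \<Longrightarrow> (\<And>x. g x \<le> f 0 x) \<Longrightarrow> P g \<le> e / 2"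
    using exhausted[OF f[of 0], of "e / 2"] e by auto
  obtain \<phi> where \<phi>: "\<phi> \<in> Lip_pos A" "\<And>x. x \<in> K \<Longrightarrow> 1 \<le> \<phi> x"
    using compact_dominated[OF closed nonempty K] by blast
  \<comment> \<open>The summand 1 covers the case \<open>P \<phi> = 0\<close> and makes
    \<open>\<delta> * P \<phi> < e / 2\<close> strict.\<close>
  define \<delta> where "\<delta> = e / (2 * (P \<phi> + 1))"
  have \<delta>: "0 < \<delta>" "\<delta> * P \<phi> < e / 2"
    using e nonneg[OF \<phi>(1)] by (auto simp: \<delta>_def field_simps)
  have "open {x. f n x < \<delta>}" for n
    by (intro open_Collect_less Lip_continuous[OF Lip_posD(1)[OF f]] continuous_on_const)
  moreover have "K \<subseteq> (\<Union>n. {x. f n x < \<delta>})"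
  proof
    fix x
    have "\<forall>\<^sub>F n in sequentially. f n x < \<delta>"
      using lim[of x] \<delta>(1) by (rule order_tendstoD(2))
    then show "x \<in> (\<Union>n. {x. f n x < \<delta>})"
      by (auto simp: eventually_sequentially)
  qed
  ultimately obtain C where C: "finite C" "K \<subseteq> (\<Union>n\<in>C. {x. f n x < \<delta>})"
    using compactE_image[OF K(1), of UNIV "\<lambda>n. {x. f n x < \<delta>}"] by auto
  show "\<exists>N. \<forall>n\<ge>N. norm (P (f n) - 0) < e"
  \<comment> \<open>The compactness argument supplies the index \<open>Max C\<close>. If
    \<open>C\<close> is empty then so is \<open>K\<close>, and the unspecified value of
    \<open>Max C\<close> does no harm.\<close>
  proof (intro exI allI impI)
    fix n assume n: "Max C \<le> n"
    have K\<delta>: "f n x < \<delta>" if x: "x \<in> K" for x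
    proof -
      obtain m where "m \<in> C" "f m x < \<delta>" using C(2) x by auto
      then show ?thesis using le[of m n x] n C(1) by (meson Max_ge le_less_trans order_trans)
    qed
    \<comment> \<open>Dini controls \<open>f n\<close> on \<open>K\<close> only. The excess of
      \<open>f n\<close> over \<open>\<delta> * \<phi>\<close> vanishes on \<open>K\<close> and lies
      below \<open>f 0\<close>, so exhaustion bounds it, while the part below costs at most
      \<open>\<delta> * P \<phi>\<close>.\<close>
    let ?g = "\<lambda>x. max (f n x - \<delta> * \<phi> x) 0"
    have d\<phi>: "0 \<le> \<delta> * \<phi> x" for x
      using \<delta>(1) Lip_posD(2)[OF \<phi>(1), of x] by simp
    have g: "?g \<in> Lip_pos A"
      by (intro Lip_pos_part Lip_diff Lip_cmult Lip_posD(1)[OF f] Lip_posD(1)[OF \<phi>(1)])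
    have "P ?g \<le> e / 2"
    proof (rule small[OF g])
      show "?g x = 0" if "x \<in> K" for x
        using K\<delta>[OF that] mult_left_mono[OF \<phi>(2)[OF that], of \<delta>] \<delta>(1) by (intro max_absorb2) linarith
      show "?g x \<le> f 0 x" for x
        using le[of 0 n x] d\<phi>[of x] Lip_posD(2)[OF f[of 0], of x] by simp
    qed
    moreover have "P (f n) \<le> P (\<lambda>x. ?g x + \<delta> * \<phi> x)"
      using g \<phi>(1) f by (intro mono Lip_add Lip_cmult) (auto simp: Lip_posD(1))
    moreover have "P (\<lambda>x. ?g x + \<delta> * \<phi> x) = P ?g + \<delta> * P \<phi>"
      using add[OF Lip_posD(1)[OF g] Lip_cmult[OF Lip_posD(1)[OF \<phi>(1)]], of \<delta>]
        cmult[OF Lip_posD(1)[OF \<phi>(1)], of \<delta>] by simp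
    ultimately show "norm (P (f n) - 0) < e"
      using \<delta>(2) nonneg[OF f, of n] by simp
  qed
qed

text \<open>The differences \<open>f - h n\<close> decrease to 0. All later limits inside
  \<open>P\<close> are taken in this form.\<close>

lemma tendsto_increasing:
  assumes f: "f \<in> Lip_pos A" and h: "\<And>n. h n \<in> Lip_pos A" and "\<And>n x. h n x \<le> f x"
    and "\<And>n x. h n x \<le> h (Suc n) x" and "\<And>x. (\<lambda>n. h n x) \<longlonglongrightarrow> f x"
  shows "(\<lambda>n. P (h n)) \<longlonglongrightarrow> P f"
proof -
  have "(\<lambda>n. P (\<lambda>x. f x - h n x)) \<longlonglongrightarrow> 0"
  proof (rule tendsto_0_decreasing)
    show "(\<lambda>x. f x - h n x) \<in> Lip_pos A" for n
      using assms by (intro Lip_pos_diff Lip_posD(1)) auto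
    show "f x - h (Suc n) x \<le> f x - h n x" for n x using assms(4) by simp
    show "(\<lambda>n. f x - h n x) \<longlonglongrightarrow> 0" for x
      using tendsto_diff[OF tendsto_const assms(5), of "f x" x] by simp
  qed
  moreover have "P (\<lambda>x. f x - h n x) = P f - P (h n)" for n
    using diff f h by (simp add: Lip_posD(1))
  ultimately have "(\<lambda>n. P f - P (h n)) \<longlonglongrightarrow> 0" by simp
  from tendsto_diff[OF tendsto_const this, of "P f"] show ?thesis by simp
qed

section \<open>The content of open sets and its outer measure\<close>

definition subordinate :: "'a set \<Rightarrow> ('a \<Rightarrow> real) set" where
  "subordinate U = {f \<in> Lip_pos A. \<forall>x. f x \<le> indicator U x}"

definition sup_content :: "'a set \<Rightarrow> ennreal" where
  "sup_content U = (SUP f\<in>subordinate U. ennreal (P f))"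

text \<open>Covering only \<open>E - A\<close> makes \<open>A\<close> a null set, as suits a measure relative to \<open>A\<close>.\<close>

definition outer :: "'a set \<Rightarrow> ennreal" where
  "outer E = (INF U\<in>{U. open U \<and> E - A \<subseteq> U}. sup_content U)"

lemma zero_subordinate: "(\<lambda>x. 0) \<in> subordinate U"
  by (simp add: subordinate_def)

lemma sup_content_upper: "f \<in> subordinate U \<Longrightarrow> ennreal (P f) \<le> sup_content U"
  unfolding sup_content_def by (rule SUP_upper)

lemma sup_content_least: "(\<And>f. f \<in> subordinate U \<Longrightarrow> ennreal (P f) \<le> c) \<Longrightarrow> sup_content U \<le> c"
  unfolding sup_content_def by (rule SUP_least)

text \<open>Elements of \<open>Lip A\<close> vanish on \<open>A\<close>, so only the part of
  \<open>U\<close> off \<open>A\<close> matters. This matches the covers of \<open>E - A\<close> in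
  \<open>outer\<close> and makes \<open>outer\<close> agree with the content on open sets.\<close>

lemma subordinate_mono:
  assumes "U - A \<subseteq> V"
  shows "subordinate U \<subseteq> subordinate V"
proof
  fix f assume f: "f \<in> subordinate U"
  have "f x \<le> indicator V x" for x
  proof (cases "x \<in> A")
    case True
    then show ?thesis using f Lip_eq_0[of f A x] by (simp add: subordinate_def Lip_pos_def)
  next
    case False
    then have "indicator U x \<le> (indicator V x :: real)" using assms by (auto split: split_indicator)
    then show ?thesis using f by (auto simp: subordinate_def intro: order_trans)
  qed
  then show "f \<in> subordinate V" using f by (simp add: subordinate_def)
qed

lemma sup_content_mono: "U - A \<subseteq> V \<Longrightarrow> sup_content U \<le> sup_content V"
  unfolding sup_content_def by (intro SUP_subset_mono subordinate_mono) auto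

lemma sup_content_empty: "sup_content {} = 0"
proof -
  have "P f = 0" if "f \<in> subordinate {}" for f
  proof -
    have "f x = 0" for x using that by (auto simp: subordinate_def Lip_pos_def intro!: antisym)
    then have "f = (\<lambda>x. 0)" by (rule ext)
    then show ?thesis using linear_functional_zero[OF linear] by simp
  qed
  then show ?thesis using sup_content_least[of "{}" 0] by simp
qed

text \<open>Lipschitz approximations from below to the indicator of \<open>U - A\<close>. Joining
  \<open>A\<close> to the complement makes them vanish on \<open>A\<close>, and it keeps the set
  nonempty when \<open>U\<close> is the whole space, where the distance to the empty set would be 0
  by convention.\<close>

definition bump :: "'a set \<Rightarrow> nat \<Rightarrow> 'a \<Rightarrow> real" where
  "bump U n x = min (real n * infdist x (A \<union> - U)) 1"

lemma bump_subordinate: "bump U n \<in> subordinate U"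
proof -
  have "(\<lambda>x. min (real n * infdist x (A \<union> - U)) 1) \<in> Lip_pos A"
    by (intro Lip_posI Lip_min_const Lip_cmult Lip_infdist) (auto simp: infdist_nonneg)
  then show ?thesis by (auto simp: subordinate_def bump_def[abs_def] split: split_indicator)
qed

lemma bump_mono: "m \<le> n \<Longrightarrow> bump U m x \<le> bump U n x"
  unfolding bump_def by (intro min.mono mult_right_mono) (auto simp: infdist_nonneg)

lemma bump_eventually_1:
  assumes "open U" "x \<in> U" "x \<notin> A"
  shows "\<forall>\<^sub>F n in sequentially. bump U n x = 1"
proof -
  have "0 < infdist x (A \<union> - U)"
    using assms closed nonempty by (intro infdist_pos_not_in_closed) (auto simp: closed_Un closed_Compl)
  then obtain N where N: "1 < real N * infdist x (A \<union> - U)"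
    using ex_less_of_nat_mult by blast
  have "bump U n x = 1" if "N \<le> n" for n
  proof -
    have "bump U N x = 1" using N by (simp add: bump_def)
    then show ?thesis using bump_mono[OF that, of U x] by (simp add: bump_def)
  qed
  then show ?thesis by (auto simp: eventually_sequentially)
qed

text \<open>A function \<open>f\<close> below the indicator of the union is capped by finite sums of
  bumps. At each point the cap eventually exceeds \<open>f\<close>, so by monotone continuity the
  finite estimates pass to \<open>P f\<close>.\<close>

lemma sup_content_countably_subadditive:
  fixes U :: "nat \<Rightarrow> 'a set"
  assumes U: "\<And>i. open (U i)"
  shows "sup_content (\<Union>i. U i) \<le> (\<Sum>i. sup_content (U i))"
proof (rule sup_content_least)
  fix f assume f: "f \<in> subordinate (\<Union>i. U i)"
  then have fL: "f \<in> Lip_pos A" and f1: "\<And>x. f x \<le> indicator (\<Union>i. U i) x"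
    by (auto simp: subordinate_def)
  have B: "bump (U i) n \<in> Lip_pos A" for i n
    using bump_subordinate[of "U i" n] by (simp add: subordinate_def)
  \<comment> \<open>One index counts the sets and also sets the steepness of the bumps, so that a
    single increasing sequence suffices.\<close>
  define s where "s n x = (\<Sum>i<n. bump (U i) n x)" for n x
  have s: "s n \<in> Lip_pos A" for n
    unfolding s_def[abs_def] by (rule Lip_pos_sum) (rule B)
  have s_mono: "s n x \<le> s (Suc n) x" for n x
  proof -
    have "s n x \<le> (\<Sum>i<n. bump (U i) (Suc n) x)"
      unfolding s_def by (intro sum_mono bump_mono) simp
    then show ?thesis using Lip_posD(2)[OF B, of n "Suc n" x] by (simp add: s_def)
  qed
  define h where "h n x = min (f x) (s n x)" for n x
  have h: "h n \<in> Lip_pos A" for n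
    unfolding h_def[abs_def] using fL s[of n] by (intro Lip_posI Lip_min) (simp_all add: Lip_posD)
  have "(\<lambda>n. P (h n)) \<longlonglongrightarrow> P f"
  proof (rule tendsto_increasing[OF fL h])
    show "h n x \<le> f x" "h n x \<le> h (Suc n) x" for n x
      using s_mono[of n x] by (auto simp: h_def)
    show "(\<lambda>n. h n x) \<longlonglongrightarrow> f x" for x
    proof (rule tendsto_eventually)
      show "\<forall>\<^sub>F n in sequentially. h n x = f x"
      proof (cases "f x = 0")
        case True
        then show ?thesis using Lip_posD(2)[OF s] by (simp add: h_def)
      next
        case False
        then have "x \<notin> A" using Lip_eq_0[OF Lip_posD(1)[OF fL]] by blast
        have "x \<in> (\<Union>i. U i)"
          using f1[of x] Lip_posD(2)[OF fL, of x] False by (auto split: split_indicator_asm)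
        then obtain i where "x \<in> U i" by blast
        have "\<forall>\<^sub>F n in sequentially. i < n \<and> bump (U i) n x = 1"
          using bump_eventually_1[OF U \<open>x \<in> U i\<close> \<open>x \<notin> A\<close>] eventually_gt_at_top[of i]
          by (simp add: eventually_conj)
        then show ?thesis
        proof eventually_elim
          case (elim n)
          then have "1 \<le> s n x"
            using member_le_sum[of i "{..<n}" "\<lambda>i. bump (U i) n x"] Lip_posD(2)[OF B]
            by (simp add: s_def)
          moreover have "f x \<le> 1" using f1[of x] by (auto split: split_indicator_asm)
          ultimately show ?case by (simp add: h_def)
        qed
      qed
    qed
  qed
  then have "(\<lambda>n. ennreal (P (h n))) \<longlonglongrightarrow> ennreal (P f)" by (rule tendsto_ennrealI)
  moreover have "ennreal (P (h n)) \<le> (\<Sum>i. sup_content (U i))" for n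
  proof -
    have "P (h n) \<le> P (s n)"
      using h s by (intro mono) (auto simp: Lip_posD(1) h_def)
    also have "\<dots> = (\<Sum>i<n. P (bump (U i) n))"
      unfolding s_def[abs_def] by (rule linear_functional_sum[OF linear B])
    finally have "ennreal (P (h n)) \<le> ennreal (\<Sum>i<n. P (bump (U i) n))" by (rule ennreal_leI)
    also have "\<dots> = (\<Sum>i<n. ennreal (P (bump (U i) n)))"
      using nonneg[OF B] by (intro sum_ennreal[symmetric]) auto
    also have "\<dots> \<le> (\<Sum>i<n. sup_content (U i))"
      by (intro sum_mono sup_content_upper bump_subordinate)
    also have "\<dots> \<le> (\<Sum>i. sup_content (U i))" by (rule sum_le_suminf) auto
    finally show ?thesis .
  qed
  ultimately show "ennreal (P f) \<le> (\<Sum>i. sup_content (U i))"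
    by (intro LIMSEQ_le_const2) auto
qed

lemma outer_mono: "E - A \<subseteq> F \<Longrightarrow> outer E \<le> outer F"
  unfolding outer_def by (intro INF_superset_mono) auto

lemma outer_le_sup_content: "open U \<Longrightarrow> E - A \<subseteq> U \<Longrightarrow> outer E \<le> sup_content U"
  unfolding outer_def by (rule INF_lower) auto

lemma outer_open: "open U \<Longrightarrow> outer U = sup_content U"
  unfolding outer_def by (intro antisym INF_lower INF_greatest sup_content_mono) auto

lemma outer_measure_space_outer: "outer_measure_space UNIV outer"
  unfolding outer_measure_space_def
proof (intro conjI)
  show "positive UNIV outer" by (simp add: positive_def outer_open sup_content_empty)
  show "increasing UNIV outer" by (auto simp: increasing_def intro: outer_mono)
  show "countably_subadditive UNIV outer"
    unfolding countably_subadditive_def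
  proof (intro allI impI)
    fix E :: "nat \<Rightarrow> 'a set"
    show "outer (\<Union>i. E i) \<le> (\<Sum>i. outer (E i))"
    proof (rule ennreal_le_epsilon)
      fix e :: real assume e: "0 < e" and "(\<Sum>n. outer (E n)) < top"
      \<comment> \<open>A finite sum has finite terms, so adding a positive amount to each is a
        strict increase and a nearly optimal open cover exists.\<close>
      then have lt: "outer (E n) < outer (E n) + ennreal (e * (1/2)^Suc n)" for n
        by (auto simp: less_top dest!: ennreal_suminf_lessD)
      have "\<exists>U. open U \<and> E n - A \<subseteq> U \<and> sup_content U < outer (E n) + ennreal (e * (1/2)^Suc n)" for n
        using lt[of n] by (subst (asm) (1) outer_def) (auto simp: INF_less_iff)
      then obtain U where U: "\<And>n. open (U n)" "\<And>n. E n - A \<subseteq> U n"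
        "\<And>n. sup_content (U n) < outer (E n) + ennreal (e * (1/2)^Suc n)" by metis
      have "outer (\<Union>i. E i) \<le> sup_content (\<Union>i. U i)"
        using U(1,2) by (intro outer_le_sup_content) blast+
      also have "\<dots> \<le> (\<Sum>i. sup_content (U i))" by (rule sup_content_countably_subadditive[OF U(1)])
      also have "\<dots> \<le> (\<Sum>n. outer (E n) + ennreal (e * (1/2)^Suc n))"
        using U(3) by (intro suminf_le) (auto simp: less_imp_le)
      also have "\<dots> = (\<Sum>n. outer (E n)) + (\<Sum>n. ennreal e * ennreal ((1/2) ^ Suc n))"
        using e by (subst suminf_add[symmetric])
          (auto simp del: ennreal_suminf_cmult simp add: ennreal_mult[symmetric])
      also have "\<dots> = (\<Sum>n. outer (E n)) + ennreal e"
        unfolding ennreal_suminf_cmult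
        by (subst suminf_ennreal_eq[OF zero_le_power power_half_series]) auto
      finally show "outer (\<Union>i. E i) \<le> (\<Sum>i. outer (E i)) + ennreal e" .
    qed
  qed
qed

text \<open>This is the Caratheodory inequality tested on open \<open>U\<close>. Lowering
  \<open>f\<close> by \<open>c = 1 / (n + 1)\<close>, cut off at 0, gives a function that vanishes
  where \<open>f < c\<close>. The open set \<open>W\<close> of such points of \<open>U\<close>
  covers \<open>U - V\<close>, since \<open>f\<close> is 0 off \<open>V\<close>; any
  \<open>g\<close> subordinate to \<open>W\<close> can therefore be added without exceeding the
  indicator of \<open>U\<close>. Monotone continuity lets \<open>c\<close> tend to 0.\<close>

lemma sup_content_Int_plus_outer_Diff:
  assumes U: "open U" and V: "open V"
  shows "sup_content (V \<inter> U) + outer (U - V) \<le> sup_content U"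
proof -
  have "ennreal (P f) + outer (U - V) \<le> sup_content U" if f: "f \<in> subordinate (V \<inter> U)" for f
  proof -
    have fL: "f \<in> Lip_pos A" and f1: "\<And>x. f x \<le> indicator (V \<inter> U) x"
      using f by (auto simp: subordinate_def)
    define h where "h n x = f x - min (f x) (inverse (real (Suc n)))" for n x
    have h: "h n \<in> Lip_pos A" for n
      unfolding h_def[abs_def] using fL by (intro Lip_pos_diff Lip_min_const) (simp_all add: Lip_posD)
    have "(\<lambda>n. P (h n)) \<longlonglongrightarrow> P f"
    proof (rule tendsto_increasing[OF fL h])
      show "h n x \<le> f x" for n x using Lip_posD(2)[OF fL, of x] by (simp add: h_def)
      have "inverse (real (Suc (Suc n))) \<le> inverse (real (Suc n))" for n
        by (intro le_imp_inverse_le) auto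
      then show "h n x \<le> h (Suc n) x" for n x by (simp add: h_def min.coboundedI2)
      have "(\<lambda>n. f x - min (f x) (inverse (real (Suc n)))) \<longlonglongrightarrow> f x - min (f x) 0" for x
        by (intro tendsto_intros LIMSEQ_inverse_real_of_nat)
      moreover have "f x - min (f x) 0 = f x" for x using Lip_posD(2)[OF fL, of x] by simp
      ultimately show "(\<lambda>n. h n x) \<longlonglongrightarrow> f x" for x unfolding h_def by metis
    qed
    then have "(\<lambda>n. ennreal (P (h n)) + outer (U - V)) \<longlonglongrightarrow> ennreal (P f) + outer (U - V)"
      by (intro tendsto_intros tendsto_ennrealI)
    moreover have "ennreal (P (h n)) + outer (U - V) \<le> sup_content U" for n
    proof -
      define W where "W = {x. f x < inverse (real (Suc n))} \<inter> U"
      have "open W"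
        unfolding W_def using U
        by (intro open_Int open_Collect_less Lip_continuous[OF Lip_posD(1)[OF fL]] continuous_on_const)
      moreover have "U - V - A \<subseteq> W"
      proof
        fix x assume "x \<in> U - V - A"
        then show "x \<in> W" using f1[of x] by (auto simp: W_def intro: le_less_trans)
      qed
      ultimately have "ennreal (P (h n)) + outer (U - V) \<le> ennreal (P (h n)) + sup_content W"
        by (intro add_left_mono outer_le_sup_content)
      also have "\<dots> = (SUP g\<in>subordinate W. ennreal (P (h n)) + ennreal (P g))"
        unfolding sup_content_def using zero_subordinate by (intro ennreal_SUP_add_right) blast
      also have "\<dots> \<le> sup_content U"
      proof (rule SUP_least)
        fix g assume g: "g \<in> subordinate W"
        then have gL: "g \<in> Lip_pos A" and g1: "\<And>x. g x \<le> indicator W x"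
          by (auto simp: subordinate_def)
        have "(\<lambda>x. h n x + g x) \<in> subordinate U"
          unfolding subordinate_def
        proof (intro CollectI conjI allI Lip_pos_add h gL)
          fix x
          define c where "c = inverse (real (Suc n))"
          have "0 < c" by (simp add: c_def)
          then show "h n x + g x \<le> indicator U x"
            using f1[of x] g1[of x] Lip_posD(2)[OF gL, of x] Lip_posD(2)[OF fL, of x]
            unfolding h_def W_def c_def[symmetric]
            by (auto simp: min_def split: split_indicator_asm split_indicator)
        qed
        then have "ennreal (P (\<lambda>x. h n x + g x)) \<le> sup_content U" by (rule sup_content_upper)
        then show "ennreal (P (h n)) + ennreal (P g) \<le> sup_content U"
          using add[OF Lip_posD(1)[OF h] Lip_posD(1)[OF gL], of n] nonneg[OF h] nonneg[OF gL]
          by simp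
      qed
      finally show ?thesis .
    qed
    ultimately show ?thesis by (intro LIMSEQ_le_const2) auto
  qed
  then have "(SUP f\<in>subordinate (V \<inter> U). ennreal (P f) + outer (U - V)) \<le> sup_content U"
    by (rule SUP_least)
  then show ?thesis
    unfolding sup_content_def using zero_subordinate by (subst (asm) ennreal_SUP_add_left) auto
qed

text \<open>The estimate for open sets passes to arbitrary \<open>E\<close> by the infimum over open
  covers of \<open>E - A\<close>; the other inequality is subadditivity.\<close>

lemma open_in_lambda_system:
  assumes V: "open V"
  shows "V \<in> lambda_system UNIV UNIV outer"
proof -
  have "outer (V \<inter> E) + outer ((UNIV - V) \<inter> E) = outer E" for E
  proof (rule antisym)
    have "outer (V \<inter> E) + outer ((UNIV - V) \<inter> E) \<le> sup_content U" if "open U" "E - A \<subseteq> U" for U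
    proof -
      have "outer (V \<inter> E) + outer ((UNIV - V) \<inter> E) \<le> sup_content (V \<inter> U) + outer (U - V)"
        using that V by (intro add_mono outer_le_sup_content outer_mono) auto
      then show ?thesis using sup_content_Int_plus_outer_Diff[OF that(1) V] by (rule order_trans)
    qed
    then show "outer (V \<inter> E) + outer ((UNIV - V) \<inter> E) \<le> outer E"
      by (subst (3) outer_def) (auto intro: INF_greatest)
    interpret ring_of_sets "UNIV :: 'a set" UNIV using sigma_algebra_Pow[of "UNIV :: 'a set"]
      by (simp add: sigma_algebra_def algebra_def)
    have "subadditive UNIV outer"
      using outer_measure_space_outer countably_subadditive_subadditive
      by (auto simp: outer_measure_space_def)
    then have "outer ((V \<inter> E) \<union> ((UNIV - V) \<inter> E)) \<le> outer (V \<inter> E) + outer ((UNIV - V) \<inter> E)"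
      by (rule subadditiveD) auto
    moreover have "(V \<inter> E) \<union> ((UNIV - V) \<inter> E) = E" by auto
    ultimately show "outer E \<le> outer (V \<inter> E) + outer ((UNIV - V) \<inter> E)" by simp
  qed
  then show ?thesis by (simp add: lambda_system_def)
qed

definition riesz_measure :: "'a measure" where
  "riesz_measure = measure_of UNIV (sets borel) outer"

lemma sets_riesz_measure [simp, measurable_cong]: "sets riesz_measure = sets borel"
  using sets.sigma_sets_eq[of "borel :: 'a measure"] by (simp add: riesz_measure_def)

lemma space_riesz_measure [simp]: "space riesz_measure = UNIV"
  using sets_eq_imp_space_eq[OF sets_riesz_measure] by simp

text \<open>\<open>measure_of\<close> returns the values of \<open>outer\<close> only if these form
  a measure. By Caratheodory they do on the measurable sets of \<open>outer\<close>, a sigma-algebra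
  that contains the open sets and hence all Borel sets.\<close>

lemma emeasure_riesz_measure:
  assumes "E \<in> sets borel"
  shows "emeasure riesz_measure E = outer E"
proof -
  have sa: "sigma_algebra (UNIV :: 'a set) (sets borel)"
    using sets.sigma_algebra_axioms[of "borel :: 'a measure"] by simp
  interpret P: sigma_algebra "UNIV :: 'a set" UNIV using sigma_algebra_Pow[of "UNIV :: 'a set"] by simp
  have ms: "measure_space UNIV (lambda_system UNIV UNIV outer) outer"
    by (rule P.caratheodory_lemma[OF outer_measure_space_outer])
  then interpret L: sigma_algebra "UNIV :: 'a set" "lambda_system UNIV UNIV outer"
    by (simp add: measure_space_def)
  have "sets borel \<subseteq> lambda_system UNIV UNIV outer"
    unfolding borel_def by (subst sets_measure_of) (auto intro!: L.sigma_sets_subset open_in_lambda_system)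
  then have "measure_space UNIV (sets borel) outer"
    using measure_down[OF ms sa] by blast
  then show ?thesis
    unfolding riesz_measure_def measure_space_def
    by (intro emeasure_measure_of_sigma) (use assms in auto)
qed

lemma emeasure_riesz_open: "open U \<Longrightarrow> emeasure riesz_measure U = sup_content U"
  by (simp add: emeasure_riesz_measure outer_open)

section \<open>Layer-cake comparison of the functional with the integral\<close>

definition slice :: "('a \<Rightarrow> real) \<Rightarrow> real \<Rightarrow> real \<Rightarrow> 'a \<Rightarrow> real" where
  "slice f s t x = min (f x) t - min (f x) s"

lemma slice_Lip_pos: "f \<in> Lip_pos A \<Longrightarrow> 0 \<le> s \<Longrightarrow> s \<le> t \<Longrightarrow> slice f s t \<in> Lip_pos A"
  unfolding slice_def[abs_def] by (intro Lip_pos_diff Lip_min_const) (auto simp: Lip_posD)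

lemma slice_add:
  assumes "f \<in> Lip_pos A" "0 \<le> s" "s \<le> t" "t \<le> u"
  shows "P (slice f s u) = P (slice f s t) + P (slice f t u)"
proof -
  have "P (\<lambda>x. slice f s t x + slice f t u x) = P (slice f s t) + P (slice f t u)"
    using assms by (intro add Lip_posD(1) slice_Lip_pos) auto
  then show ?thesis by (simp add: slice_def[abs_def])
qed

text \<open>Divided by its height \<open>t - s\<close>, the slice is at most 1 and vanishes where
  \<open>f \<le> s\<close>, so it competes in the supremum that defines the content.\<close>

lemma P_slice_le:
  assumes f: "f \<in> Lip_pos A" and t: "0 \<le> s" "s < t"
  shows "ennreal (P (slice f s t)) \<le> ennreal (t - s) * emeasure riesz_measure {x. s < f x}"
proof -
  have sl: "slice f s t \<in> Lip_pos A" using slice_Lip_pos[OF f] t by simp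
  let ?u = "\<lambda>x. inverse (t - s) * slice f s t x"
  have "?u \<in> Lip_pos A" using sl t by (intro Lip_pos_cmult) auto
  moreover have "?u x \<le> indicator {x. s < f x} x" for x
    using t by (auto simp: slice_def min_def field_simps split: split_indicator)
  ultimately have "?u \<in> subordinate {x. s < f x}" by (simp add: subordinate_def)
  then have "ennreal (t - s) * ennreal (P ?u) \<le> ennreal (t - s) * sup_content {x. s < f x}"
    by (intro mult_left_mono sup_content_upper) auto
  moreover have "ennreal (t - s) * ennreal (P ?u) = ennreal (P (slice f s t))"
    using cmult[OF Lip_posD(1)[OF sl], of "inverse (t - s)"] t nonneg[OF sl]
    by (simp add: ennreal_mult[symmetric])
  moreover have "open {x. s < f x}"
    by (intro open_Collect_less Lip_continuous[OF Lip_posD(1)[OF f]] continuous_on_const)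
  ultimately show ?thesis by (simp add: emeasure_riesz_open)
qed

text \<open>Where \<open>f > t\<close> the slice has its full height \<open>t - s\<close>, so it
  dominates \<open>t - s\<close> times any competitor for the content of that set.\<close>

lemma P_slice_ge:
  assumes f: "f \<in> Lip_pos A" and t: "0 \<le> s" "s < t"
  shows "ennreal (t - s) * emeasure riesz_measure {x. t < f x} \<le> ennreal (P (slice f s t))"
proof -
  have sl: "slice f s t \<in> Lip_pos A" using slice_Lip_pos[OF f] t by simp
  have "open {x. t < f x}"
    by (intro open_Collect_less Lip_continuous[OF Lip_posD(1)[OF f]] continuous_on_const)
  then have "ennreal (t - s) * emeasure riesz_measure {x. t < f x} =
      (SUP u\<in>subordinate {x. t < f x}. ennreal (t - s) * ennreal (P u))"
    by (simp add: emeasure_riesz_open sup_content_def SUP_mult_left_ennreal)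
  also have "\<dots> \<le> ennreal (P (slice f s t))"
  proof (rule SUP_least)
    fix u assume u: "u \<in> subordinate {x. t < f x}"
    then have uL: "u \<in> Lip_pos A" by (simp add: subordinate_def)
    have "P (\<lambda>x. (t - s) * u x) \<le> P (slice f s t)"
    proof (intro mono Lip_cmult Lip_posD(1)[OF uL] Lip_posD(1)[OF sl])
      fix x
      have "(t - s) * u x \<le> (t - s) * indicator {x. t < f x} x"
        using u t by (intro mult_left_mono) (auto simp: subordinate_def)
      also have "\<dots> \<le> slice f s t x"
        using t Lip_posD(2)[OF sl, of x] by (auto simp: slice_def split: split_indicator)
      finally show "(t - s) * u x \<le> slice f s t x" .
    qed
    then have "(t - s) * P u \<le> P (slice f s t)"
      using cmult[OF Lip_posD(1)[OF uL]] by simp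
    then show "ennreal (t - s) * ennreal (P u) \<le> ennreal (P (slice f s t))"
      using t nonneg[OF uL] by (simp add: ennreal_mult[symmetric] ennreal_leI)
  qed
  finally show ?thesis .
qed

lemma measurable_Lip_pos: "f \<in> Lip_pos A \<Longrightarrow> f \<in> borel_measurable borel"
  by (intro Lip_measurable Lip_posD(1))

lemma sets_superlevel: "f \<in> Lip_pos A \<Longrightarrow> {x. t < f x} \<in> sets borel"
  using borel_measurable_less[of "\<lambda>_. t" borel f] measurable_Lip_pos[of f] by simp

lemma nn_integral_slice_le:
  assumes f: "f \<in> Lip_pos A" and t: "0 \<le> s" "s < t"
  shows "(\<integral>\<^sup>+x. slice f s t x \<partial>riesz_measure) \<le> ennreal (t - s) * emeasure riesz_measure {x. s < f x}"
proof -
  have "(\<integral>\<^sup>+x. slice f s t x \<partial>riesz_measure) \<le>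
      (\<integral>\<^sup>+x. ennreal (t - s) * indicator {x. s < f x} x \<partial>riesz_measure)"
    using t by (intro nn_integral_mono)
      (auto simp: slice_def min_def ennreal_leI split: split_indicator)
  then show ?thesis using sets_superlevel[OF f] by (simp add: nn_integral_cmult_indicator)
qed

lemma nn_integral_slice_ge:
  assumes f: "f \<in> Lip_pos A" and t: "0 \<le> s" "s < t"
  shows "ennreal (t - s) * emeasure riesz_measure {x. t < f x} \<le> (\<integral>\<^sup>+x. slice f s t x \<partial>riesz_measure)"
proof -
  have "(\<integral>\<^sup>+x. ennreal (t - s) * indicator {x. t < f x} x \<partial>riesz_measure) \<le>
      (\<integral>\<^sup>+x. slice f s t x \<partial>riesz_measure)"
    using t by (intro nn_integral_mono)
      (auto simp: slice_def min_def ennreal_leI split: split_indicator)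
  then show ?thesis using sets_superlevel[OF f] by (simp add: nn_integral_cmult_indicator)
qed

lemma nn_integral_slice_add:
  assumes f: "f \<in> Lip_pos A" and t: "0 \<le> s" "s \<le> t" "t \<le> u"
  shows "(\<integral>\<^sup>+x. slice f s u x \<partial>riesz_measure) =
    (\<integral>\<^sup>+x. slice f s t x \<partial>riesz_measure) + (\<integral>\<^sup>+x. slice f t u x \<partial>riesz_measure)"
proof -
  have "ennreal (slice f s u x) = ennreal (slice f s t x) + ennreal (slice f t u x)" for x
    using t slice_Lip_pos[OF f, of s t] slice_Lip_pos[OF f, of t u]
    by (subst ennreal_plus[symmetric]) (auto simp: Lip_posD slice_def)
  moreover have "slice f s t \<in> borel_measurable borel" "slice f t u \<in> borel_measurable borel"
    using t slice_Lip_pos[OF f] by (auto intro!: measurable_Lip_pos)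
  ultimately show ?thesis by (simp add: nn_integral_add)
qed

text \<open>Between the levels \<open>k * h\<close> and \<open>(k + 1) * h\<close> both \<open>P\<close> and the integral of a slice are squeezed
  between \<open>h\<close> times the measures of the two superlevel sets; hence each is bounded by the other
  one shifted by one level.\<close>

lemma nn_integral_slices_le:
  assumes f: "f \<in> Lip_pos A" and h: "0 < h"
  shows "(\<integral>\<^sup>+x. slice f h (real (Suc n) * h) x \<partial>riesz_measure) \<le> ennreal (P (slice f 0 (real n * h)))"
proof (induction n)
  case 0
  then show ?case by (simp add: slice_def)
next
  case (Suc n)
  let ?a = "real n * h" and ?b = "real (Suc n) * h" and ?c = "real (Suc (Suc n)) * h"
  have le: "0 \<le> ?a" "?a < ?b" "?b < ?c" "h \<le> ?b"
    using h by (auto simp: algebra_simps)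
  have eq: "?b - ?a = h" "?c - ?b = h" by (simp_all add: algebra_simps)
  have "(\<integral>\<^sup>+x. slice f h ?c x \<partial>riesz_measure) =
      (\<integral>\<^sup>+x. slice f h ?b x \<partial>riesz_measure) + (\<integral>\<^sup>+x. slice f ?b ?c x \<partial>riesz_measure)"
    using le h by (intro nn_integral_slice_add[OF f]) auto
  also have "(\<integral>\<^sup>+x. slice f ?b ?c x \<partial>riesz_measure) \<le> ennreal (P (slice f ?a ?b))"
    using nn_integral_slice_le[OF f, of ?b ?c, unfolded eq] P_slice_ge[OF f, of ?a ?b, unfolded eq] le
    by (meson order_trans less_imp_le)
  also note Suc
  also have "ennreal (P (slice f 0 ?a)) + ennreal (P (slice f ?a ?b)) = ennreal (P (slice f 0 ?b))"
    using le slice_add[OF f, of 0 ?a ?b]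
    by (simp add: ennreal_plus[symmetric] nonneg slice_Lip_pos[OF f] del: ennreal_plus)
  finally show ?case by (simp add: add_left_mono add_right_mono)
qed

lemma P_slices_le:
  assumes f: "f \<in> Lip_pos A" and h: "0 < h"
  shows "ennreal (P (slice f h (real (Suc n) * h))) \<le> (\<integral>\<^sup>+x. slice f 0 (real n * h) x \<partial>riesz_measure)"
proof (induction n)
  case 0
  then show ?case using linear_functional_zero[OF linear] by (simp add: slice_def[abs_def])
next
  case (Suc n)
  let ?a = "real n * h" and ?b = "real (Suc n) * h" and ?c = "real (Suc (Suc n)) * h"
  have le: "0 \<le> ?a" "?a < ?b" "?b < ?c" "h \<le> ?b"
    using h by (auto simp: algebra_simps)
  have eq: "?b - ?a = h" "?c - ?b = h" by (simp_all add: algebra_simps)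
  have "ennreal (P (slice f h ?c)) = ennreal (P (slice f h ?b)) + ennreal (P (slice f ?b ?c))"
    using le h slice_add[OF f, of h ?b ?c]
    by (simp add: ennreal_plus[symmetric] nonneg slice_Lip_pos[OF f] del: ennreal_plus)
  also have "ennreal (P (slice f ?b ?c)) \<le> (\<integral>\<^sup>+x. slice f ?a ?b x \<partial>riesz_measure)"
    using P_slice_le[OF f, of ?b ?c, unfolded eq] nn_integral_slice_ge[OF f, of ?a ?b, unfolded eq] le
    by (meson order_trans less_imp_le)
  also note Suc
  also have "(\<integral>\<^sup>+x. slice f 0 ?a x \<partial>riesz_measure) + (\<integral>\<^sup>+x. slice f ?a ?b x \<partial>riesz_measure) =
      (\<integral>\<^sup>+x. slice f 0 ?b x \<partial>riesz_measure)"
    using le by (intro nn_integral_slice_add[OF f, symmetric]) auto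
  finally show ?case by (simp add: add_left_mono add_right_mono)
qed

text \<open>The shift by one level in the slice estimates disappears in the limit: slices that start
  at the level \<open>h m\<close> increase to \<open>f\<close> as the mesh shrinks. The limit is
  taken by monotone continuity for \<open>P\<close> and by Fatou for the integral.\<close>

lemma nn_integral_riesz_measure:
  assumes f: "f \<in> Lip_pos A"
  shows "(\<integral>\<^sup>+x. f x \<partial>riesz_measure) = ennreal (P f)"
proof -
  \<comment> \<open>The mesh \<open>h m\<close> tends to 0 while \<open>k m\<close> meshes reach the
    height \<open>Suc m\<close>, which tends to infinity.\<close>
  define h where "h m = inverse (real (Suc m))" for m
  define k where "k m = Suc m * Suc m" for m
  have h: "0 < h m" for m by (simp add: h_def)
  have h_dec: "h (Suc m) \<le> h m" for m
    unfolding h_def by (intro le_imp_inverse_le) auto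
  have h_lim: "h \<longlonglongrightarrow> 0" unfolding h_def[abs_def] by (rule LIMSEQ_inverse_real_of_nat)
  have kh: "real (k m) * h m = real (Suc m)" "real (Suc (k m)) * h m = real (Suc m) + h m" for m
    by (simp_all add: k_def h_def field_simps)
  let ?s = "\<lambda>m. slice f (h m) (real (Suc (k m)) * h m)"
  have kh_ge: "h m \<le> real (Suc (k m)) * h m" for m
    unfolding kh by simp
  have s: "?s m \<in> Lip_pos A" for m
    using h[of m] kh_ge by (intro slice_Lip_pos[OF f]) auto
  have s_le: "?s m x \<le> f x" for m x
    using Lip_posD(2)[OF f, of x] h[of m] by (auto simp: slice_def min_def)
  have s_mono: "?s m x \<le> ?s (Suc m) x" for m x
  proof -
    \<comment> \<open>The upper level rises although \<open>h\<close> falls: the integer part gains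
      1 and \<open>h m\<close> is at most 1.\<close>
    have "real (Suc m) + h m \<le> real (Suc (Suc m)) + h (Suc m)"
    proof -
      have "h m \<le> 1" unfolding h_def by (rule inverse_le_1_iff[THEN iffD2]) simp
      then show ?thesis using h[of "Suc m"] by simp
    qed
    then have "min (f x) (real (Suc m) + h m) \<le> min (f x) (real (Suc (Suc m)) + h (Suc m))"
      by (rule min.mono[OF order_refl])
    moreover have "min (f x) (h (Suc m)) \<le> min (f x) (h m)"
      using h_dec by (rule min.mono[OF order_refl])
    ultimately show ?thesis unfolding slice_def kh by linarith
  qed
  have s_lim: "(\<lambda>m. ?s m x) \<longlonglongrightarrow> f x" for x
  proof -
    have "\<forall>\<^sub>F m in sequentially. ?s m x = f x - min (f x) (h m)"
    proof -
      obtain N where "f x < real N" using reals_Archimedean2 by blast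
      then have "?s m x = f x - min (f x) (h m)" if "N \<le> m" for m
        using that h[of m] unfolding slice_def kh by simp
      then show ?thesis by (auto simp: eventually_sequentially)
    qed
    moreover have "(\<lambda>m. f x - min (f x) (h m)) \<longlonglongrightarrow> f x - min (f x) 0"
      by (intro tendsto_intros h_lim)
    ultimately show ?thesis
      using Lip_posD(2)[OF f, of x] by (simp add: tendsto_cong)
  qed
  have "ennreal (P (?s m)) \<le> (\<integral>\<^sup>+x. f x \<partial>riesz_measure)" for m
  proof (rule order_trans[OF P_slices_le[OF f h] nn_integral_mono])
    show "ennreal (slice f 0 (real (k m) * h m) x) \<le> ennreal (f x)" for x
      using Lip_posD(2)[OF f, of x] by (intro ennreal_leI) (simp add: slice_def)
  qed
  moreover have "(\<lambda>m. ennreal (P (?s m))) \<longlonglongrightarrow> ennreal (P f)"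
    by (intro tendsto_ennrealI tendsto_increasing f s s_le s_mono s_lim)
  ultimately have ge: "ennreal (P f) \<le> (\<integral>\<^sup>+x. f x \<partial>riesz_measure)"
    by (intro LIMSEQ_le_const2) auto
  have "(\<integral>\<^sup>+x. f x \<partial>riesz_measure) = (\<integral>\<^sup>+x. liminf (\<lambda>m. ennreal (?s m x)) \<partial>riesz_measure)"
    by (intro nn_integral_cong lim_imp_Liminf[symmetric] tendsto_ennrealI s_lim) simp
  also have "\<dots> \<le> liminf (\<lambda>m. \<integral>\<^sup>+x. ennreal (?s m x) \<partial>riesz_measure)"
    using measurable_Lip_pos[OF s] by (intro nn_integral_liminf) simp
  also have "\<dots> \<le> ennreal (P f)"
  proof -
    have "(\<integral>\<^sup>+x. ennreal (?s m x) \<partial>riesz_measure) \<le> ennreal (P f)" for m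
    proof (rule order_trans[OF nn_integral_slices_le[OF f h] ennreal_leI])
      show "P (slice f 0 (real (k m) * h m)) \<le> P f"
        using h[of m] Lip_posD[OF f] slice_Lip_pos[OF f, of 0 "real (k m) * h m"]
        by (intro mono) (auto simp: Lip_posD slice_def)
    qed
    then show ?thesis by (intro Liminf_le) auto
  qed
  finally show ?thesis using ge by (rule antisym)
qed

section \<open>Regularity of the measure\<close>

lemma emeasure_compact_finite:
  assumes "compact K" "K \<subseteq> - A"
  shows "emeasure riesz_measure K < \<infinity>"
proof -
  obtain \<phi> where \<phi>: "\<phi> \<in> Lip_pos A" "\<And>x. x \<in> K \<Longrightarrow> 1 \<le> \<phi> x"
    using compact_dominated[OF closed nonempty assms] by blast
  have "emeasure riesz_measure K = (\<integral>\<^sup>+x. indicator K x \<partial>riesz_measure)"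
    using compact_imp_closed[OF assms(1)] by simp
  also have "\<dots> \<le> (\<integral>\<^sup>+x. \<phi> x \<partial>riesz_measure)"
    using \<phi>(2) by (intro nn_integral_mono) (auto split: split_indicator)
  finally show ?thesis
    using nn_integral_riesz_measure[OF \<phi>(1)] by (simp add: le_less_trans ennreal_less_top)
qed

lemma outer_regular:
  assumes "E \<in> sets borel" "E \<subseteq> - A" "emeasure riesz_measure E < \<infinity>" "0 < e"
  obtains U where "open U" "E \<subseteq> U" "emeasure riesz_measure U < emeasure riesz_measure E + ennreal e"
proof -
  have "outer E < outer E + ennreal e"
    using assms(1,3,4)
    by (cases "outer E") (simp_all add: emeasure_riesz_measure ennreal_less_iff flip: ennreal_plus)
  then have "\<exists>U. open U \<and> E - A \<subseteq> U \<and> sup_content U < outer E + ennreal e"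
    by (subst (asm) (1) outer_def) (auto simp: INF_less_iff)
  then show ?thesis
    using that assms by (auto simp: emeasure_riesz_measure[OF assms(1)] emeasure_riesz_open)
qed

text \<open>On \<open>F\<close> the multiple \<open>f\<close> of the distance to \<open>A\<close> is
  at least 1. Exhaustion for \<open>f\<close> yields \<open>K\<close>; the functions
  \<open>g n\<close> vanish on \<open>K\<close>, stay below \<open>f\<close> and are eventually at
  least 1 at each point of \<open>F - K\<close>, so Fatou transfers the bound on \<open>P\<close> to
  the measure. The set \<open>K\<close> need not lie inside \<open>F\<close>.\<close>

lemma emeasure_diff_compact_le:
  assumes F: "F \<in> sets borel" and r: "0 < r" "\<And>x. x \<in> F \<Longrightarrow> r \<le> infdist x A" and e: "0 < e"
  obtains K where "compact K" "K \<subseteq> - A" "emeasure riesz_measure (F - K) \<le> ennreal e"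
proof -
  define f where "f x = inverse r * infdist x A" for x
  have f: "f \<in> Lip_pos A"
    unfolding f_def[abs_def] using r(1)
    by (intro Lip_posI Lip_cmult Lip_infdist) (auto simp: infdist_nonneg)
  obtain K where K: "compact K" "K \<subseteq> - A"
    and small: "\<And>g. g \<in> Lip_pos A \<Longrightarrow> (\<And>x. x \<in> K \<Longrightarrow> g x = 0) \<Longrightarrow> (\<And>x. g x \<le> f x) \<Longrightarrow> P g \<le> e"
    using exhausted[OF f e] by auto
  define g where "g n x = min (f x) (real n * infdist x (K \<union> A))" for n :: nat and x
  have g: "g n \<in> Lip_pos A" for n
    unfolding g_def[abs_def] using f
    by (intro Lip_posI Lip_min Lip_cmult Lip_infdist) (auto simp: infdist_nonneg Lip_posD)
  have g_lim: "indicator (F - K) x \<le> liminf (\<lambda>n. ennreal (g n x))" for x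
  proof (cases "x \<in> F - K")
    case True
    then have "0 < infdist x (K \<union> A)"
      using closed nonempty K r(1) r(2)[of x]
      by (intro infdist_pos_not_in_closed) (auto simp: compact_imp_closed)
    then obtain N where N: "1 < real N * infdist x (K \<union> A)"
      using ex_less_of_nat_mult by blast
    have "1 \<le> g n x" if "N \<le> n" for n
    proof -
      have "real N * infdist x (K \<union> A) \<le> real n * infdist x (K \<union> A)"
        using that by (intro mult_right_mono) (auto simp: infdist_nonneg)
      then show ?thesis using N r(1) r(2)[of x] True by (auto simp: g_def f_def field_simps)
    qed
    then have "\<forall>\<^sub>F n in sequentially. 1 \<le> ennreal (g n x)"
      by (auto simp: eventually_sequentially)
    then show ?thesis using True by (auto intro: Liminf_bounded)
  qed simp
  have "K \<in> sets borel" using K by (simp add: compact_imp_closed)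
  then have "emeasure riesz_measure (F - K) = (\<integral>\<^sup>+x. indicator (F - K) x \<partial>riesz_measure)"
    using F by simp
  also have "\<dots> \<le> (\<integral>\<^sup>+x. liminf (\<lambda>n. ennreal (g n x)) \<partial>riesz_measure)"
    by (intro nn_integral_mono g_lim)
  also have "\<dots> \<le> liminf (\<lambda>n. \<integral>\<^sup>+x. ennreal (g n x) \<partial>riesz_measure)"
    using measurable_Lip_pos[OF g] by (intro nn_integral_liminf) simp
  also have "\<dots> \<le> ennreal e"
  proof -
    have "P (g n) \<le> e" for n
      by (rule small[OF g]) (auto simp: g_def min_absorb2 Lip_posD(2)[OF f])
    then show ?thesis
      by (intro Liminf_le) (auto simp: nn_integral_riesz_measure[OF g] ennreal_leI)
  qed
  finally show ?thesis using that K by blast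
qed

text \<open>To push the compact set \<open>K\<close> into \<open>F\<close>, an open set
  \<open>U\<close> only slightly larger in measure than \<open>K - F\<close> is removed from it.
  Outer regularity provides \<open>U\<close>, since \<open>K\<close> and thus \<open>K - F\<close>
  have finite measure.\<close>

lemma compact_approx:
  assumes F: "F \<in> sets borel" and r: "0 < r" "\<And>x. x \<in> F \<Longrightarrow> r \<le> infdist x A" and e: "0 < e"
  obtains C where "compact C" "C \<subseteq> F" "emeasure riesz_measure F \<le> emeasure riesz_measure C + ennreal e"
proof -
  obtain K where K: "compact K" "K \<subseteq> - A" "emeasure riesz_measure (F - K) \<le> ennreal (e / 2)"
    using emeasure_diff_compact_le[OF F r, of "e / 2"] e by auto
  have Kb: "K \<in> sets borel" using K by (simp add: compact_imp_closed)
  have "emeasure riesz_measure (K - F) \<le> emeasure riesz_measure K"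
    using Kb by (intro emeasure_mono) auto
  then have fin: "emeasure riesz_measure (K - F) < \<infinity>"
    using emeasure_compact_finite[OF K(1,2)] by (rule le_less_trans)
  obtain U where U: "open U" "K - F \<subseteq> U"
      "emeasure riesz_measure U < emeasure riesz_measure (K - F) + ennreal (e / 2)"
    using outer_regular[of "K - F" "e / 2"] fin F Kb K(2) e by (auto simp: sets.Diff)
  have small: "emeasure riesz_measure (U - (K - F)) \<le> ennreal (e / 2)"
  proof -
    have "emeasure riesz_measure (U - (K - F)) = emeasure riesz_measure U - emeasure riesz_measure (K - F)"
      using fin U(1,2) F Kb by (intro emeasure_Diff) auto
    also have "\<dots> \<le> ennreal (e / 2)"
      using U(3) fin by (subst ennreal_minus_le_iff) (auto simp: less_imp_le)
    finally show ?thesis .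
  qed
  have C: "compact (K - U)" using K(1) U(1) by (rule compact_diff)
  \<comment> \<open>A point of \<open>F\<close> that lies in \<open>K\<close> but not in
    \<open>K - U\<close> belongs to \<open>U\<close> and, being in \<open>F\<close>, not to
    \<open>K - F\<close>.\<close>
  have "emeasure riesz_measure F \<le> emeasure riesz_measure ((K - U) \<union> ((F - K) \<union> (U - (K - F))))"
    using F Kb U(1) by (intro emeasure_mono) auto
  also have "\<dots> \<le> emeasure riesz_measure (K - U) + emeasure riesz_measure ((F - K) \<union> (U - (K - F)))"
    using F Kb U(1) by (intro emeasure_subadditive) auto
  also have "\<dots> \<le> emeasure riesz_measure (K - U) +
      (emeasure riesz_measure (F - K) + emeasure riesz_measure (U - (K - F)))"
    using F Kb U(1) by (intro add_left_mono emeasure_subadditive) auto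
  also have "\<dots> \<le> emeasure riesz_measure (K - U) + (ennreal (e / 2) + ennreal (e / 2))"
    using K(3) small by (intro add_left_mono add_mono)
  also have "ennreal (e / 2) + ennreal (e / 2) = ennreal e"
    using e by (subst ennreal_plus[symmetric]) auto
  finally show ?thesis using that[OF C] U(2) by blast
qed

text \<open>As \<open>A\<close> is closed, \<open>E\<close> is the increasing union of its parts at
  distance at least \<open>1 / (n + 1)\<close> from \<open>A\<close>, and each part has compact
  approximations.\<close>

lemma inner_regular:
  assumes E: "E \<in> sets borel" "E \<subseteq> - A"
  shows "emeasure riesz_measure E = (SUP K\<in>{K. compact K \<and> K \<subseteq> E}. emeasure riesz_measure K)"
    (is "_ = ?s")
proof (rule antisym)
  define F where "F n = E \<inter> {x. inverse (real (Suc n)) \<le> infdist x A}" for n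
  have F: "F n \<in> sets borel" for n
  proof -
    have "closed {x. inverse (real (Suc n)) \<le> infdist x A}"
      by (intro closed_Collect_le continuous_intros)
    then show ?thesis unfolding F_def by (rule sets.Int[OF E(1) borel_closed])
  qed
  have "E \<subseteq> (\<Union>n. F n)"
  proof
    fix x assume x: "x \<in> E"
    then have "0 < infdist x A"
      using E(2) closed nonempty by (intro infdist_pos_not_in_closed) auto
    then obtain n where "inverse (real (Suc n)) < infdist x A" using reals_Archimedean by blast
    then show "x \<in> (\<Union>n. F n)" using x by (auto simp: F_def intro!: exI[of _ n])
  qed
  then have E_eq: "E = (\<Union>n. F n)" by (auto simp: F_def)
  have "incseq F"
  proof (rule incseq_SucI)
    fix n
    have "inverse (real (Suc (Suc n))) \<le> inverse (real (Suc n))" by (intro le_imp_inverse_le) auto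
    then show "F n \<subseteq> F (Suc n)" unfolding F_def by (blast intro: order_trans)
  qed
  then have "emeasure riesz_measure E = (SUP n. emeasure riesz_measure (F n))"
    using F by (subst E_eq) (auto intro!: SUP_emeasure_incseq[symmetric])
  also have "\<dots> \<le> ?s"
  proof (rule SUP_least, rule ennreal_le_epsilon)
    fix n and e :: real assume "0 < e"
    obtain C where C: "compact C" "C \<subseteq> F n"
        "emeasure riesz_measure (F n) \<le> emeasure riesz_measure C + ennreal e"
      using compact_approx[OF F _ _ \<open>0 < e\<close>, of "inverse (real (Suc n))" n] by (auto simp: F_def)
    have "emeasure riesz_measure C \<le> ?s"
      using C(1,2) by (intro SUP_upper) (auto simp: F_def)
    then show "emeasure riesz_measure (F n) \<le> ?s + ennreal e"
      using C(3) by (meson add_right_mono order_trans)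
  qed
  finally show "emeasure riesz_measure E \<le> ?s" .
  show "?s \<le> emeasure riesz_measure E"
    using E(1) by (intro SUP_least emeasure_mono) auto
qed

end

section \<open>Functionals induced by tight relative measures\<close>

lemma relative_classI:
  assumes "closed A" "\<mu> \<in> borel_measures"
  shows "relative_eq A `` {\<mu>} \<in> relative_borel_measures A" "\<mu> \<in> relative_eq A `` {\<mu>}"
  using assms equiv_class_self[OF equiv_relative_eq]
  by (auto simp: relative_borel_measures_def intro: quotientI)

lemma M1_posD:
  assumes "M \<in> M1_pos A" "closed A"
  shows "M \<in> relative_borel_measures A" "sets (rep_measure M) = sets borel"
    "(\<integral>\<^sup>+x. ennreal (infdist x A) \<partial>rep_measure M) < \<infinity>" "tight A M"
proof -
  show M: "M \<in> relative_borel_measures A" using assms by (simp add: M1_pos_def)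
  show "sets (rep_measure M) = sets borel"
    using related_rep_measure[OF assms(2) M rep_measure_in[OF assms(2) M]]
    by (auto simp: relative_eq_def borel_measures_def)
qed (use assms in \<open>auto simp: M1_pos_def\<close>)

lemma M1_pos_integrable:
  assumes A: "closed A" "A \<noteq> {}" and M: "M \<in> M1_pos A" and f: "f \<in> Lip A"
  shows "integrable (rep_measure M) f"
proof -
  note [measurable_cong] = M1_posD(2)[OF M A(1)]
  obtain L where L: "0 \<le> L" "\<And>x. \<bar>f x\<bar> \<le> L * infdist x A"
    using Lip_le_infdist[OF f A(2)] by blast
  have [measurable]: "(\<lambda>x. infdist x A) \<in> borel_measurable borel"
    by (rule Lip_measurable[OF Lip_infdist[of A A]]) simp
  have [measurable]: "f \<in> borel_measurable borel" by (rule Lip_measurable[OF f])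
  have "integrable (rep_measure M) (\<lambda>x. infdist x A)"
    using M1_posD(3)[OF M A(1)] by (intro integrableI_nonneg) (auto simp: infdist_nonneg)
  then have "integrable (rep_measure M) (\<lambda>x. L * infdist x A)" by simp
  then show ?thesis
    by (rule Bochner_Integration.integrable_bound) (use L in \<open>auto simp: infdist_nonneg\<close>)
qed

lemma M1_pos_positive_functional:
  assumes A: "closed A" "A \<noteq> {}" and M: "M \<in> M1_pos A"
  shows "positive_functional A (rel_integral M)"
  using M1_pos_integrable[OF A M]
  by (auto simp: positive_functional_def linear_functional_def rel_integral_def Lip_posD)

lemma M1_pos_eqI:
  assumes A: "closed A" "A \<noteq> {}" and M: "M \<in> M1_pos A" and N: "N \<in> M1_pos A"
    and eq: "\<And>f. f \<in> Lip_pos A \<Longrightarrow> rel_integral M f = rel_integral N f"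
  shows "M = N"
proof -
  have K_eq: "emeasure (rep_measure M) K = emeasure (rep_measure N) K"
    if K: "compact K" "K \<subseteq> - A" for K
  proof -
    obtain \<phi> where \<phi>: "\<phi> \<in> Lip_pos A" "\<And>x. x \<in> K \<Longrightarrow> 1 \<le> \<phi> x"
      using compact_dominated[OF A K] by blast
    \<comment> \<open>The cap makes \<open>\<psi>\<close> equal to 1 on \<open>K\<close>, so that
      the limit is exactly the indicator.\<close>
    define \<psi> where "\<psi> x = min (\<phi> x) 1" for x
    have \<psi>: "\<psi> \<in> Lip_pos A" unfolding \<psi>_def[abs_def] using \<phi>(1) by (intro Lip_pos_min_const) auto
    \<comment> \<open>On \<open>K\<close> nothing is subtracted, and off \<open>K \<union> A\<close>
      the subtracted term eventually equals \<open>\<psi>\<close>. Joining \<open>A\<close> keeps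
      the distance in \<open>Lip A\<close>, and the set nonempty even if \<open>K\<close> is
      empty.\<close>
    define f where "f n x = \<psi> x - min (\<psi> x) (real n * infdist x (K \<union> A))" for n :: nat and x
    have f: "f n \<in> Lip_pos A" for n
      unfolding f_def[abs_def] using \<psi>
      by (intro Lip_pos_diff Lip_min Lip_cmult Lip_infdist) (auto simp: Lip_posD)
    have lim: "(\<lambda>n. f n x) \<longlonglongrightarrow> indicator K x" for x
    proof (rule tendsto_eventually)
      show "\<forall>\<^sub>F n in sequentially. f n x = indicator K x"
      proof (cases "x \<in> K \<union> A")
        case True
        moreover have "\<psi> x = indicator K x"
          using True \<phi>(2)[of x] K(2) Lip_eq_0[OF Lip_posD(1)[OF \<psi>], of x]
          by (auto simp: \<psi>_def split: split_indicator)
        ultimately show ?thesis by (auto simp: f_def)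
      next
        case False
        then have "0 < infdist x (K \<union> A)"
          using A K by (intro infdist_pos_not_in_closed) (auto simp: compact_imp_closed)
        then obtain m where m: "1 < real m * infdist x (K \<union> A)"
          using ex_less_of_nat_mult by blast
        have "f n x = 0" if "m \<le> n" for n
        proof -
          have "real m * infdist x (K \<union> A) \<le> real n * infdist x (K \<union> A)"
            using that by (intro mult_right_mono) (auto simp: infdist_nonneg)
          then show ?thesis using m by (auto simp: f_def \<psi>_def)
        qed
        then show ?thesis using False by (auto simp: eventually_sequentially)
      qed
    qed
    \<comment> \<open>Domination by the integrable \<open>\<psi>\<close> also shows that
      \<open>K\<close> has finite measure, which allows the return from real limits to
      \<open>emeasure\<close>.\<close>
    have conv: "(\<lambda>n. rel_integral R (f n)) \<longlonglongrightarrow> measure (rep_measure R) K \<and>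
        emeasure (rep_measure R) K = ennreal (measure (rep_measure R) K)" if R: "R \<in> M1_pos A" for R
    proof -
      note [measurable_cong] = M1_posD(2)[OF R A(1)]
      have [measurable]: "K \<in> sets borel" using K by (simp add: compact_imp_closed)
      have fm: "f n \<in> borel_measurable (rep_measure R)" for n
        using Lip_measurable[OF Lip_posD(1)[OF f]] by simp
      have bound: "AE x in rep_measure R. norm (f n x) \<le> \<psi> x" for n
        using Lip_posD(2)[OF f[of n]] Lip_posD(2)[OF \<psi>]
        by (auto simp: f_def infdist_nonneg)
      note dc = fm _ M1_pos_integrable[OF A R Lip_posD(1)[OF \<psi>]] AE_I2[OF lim] bound
      have "integrable (rep_measure R) (indicator K :: _ \<Rightarrow> real)"
        by (rule integrable_dominated_convergence[OF _ dc(1,3,4,5)]) simp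
      then have "emeasure (rep_measure R) K < \<infinity>"
        by (simp add: integrable_indicator_iff sets_eq_imp_space_eq[OF M1_posD(2)[OF R A(1)]])
      moreover have "(\<lambda>n. \<integral>x. f n x \<partial>rep_measure R) \<longlonglongrightarrow> (\<integral>x. indicator K x \<partial>rep_measure R)"
        by (rule integral_dominated_convergence[OF _ dc(1,3,4,5)]) simp
      ultimately show ?thesis
        by (simp add: rel_integral_def emeasure_eq_ennreal_measure sets_eq_imp_space_eq[OF M1_posD(2)[OF R A(1)]])
    qed
    then show ?thesis
      using LIMSEQ_unique[of "\<lambda>n. rel_integral M (f n)"] conv[OF M] conv[OF N] eq[OF f] by auto
  qed
  have E_eq: "emeasure (rep_measure M) E = emeasure (rep_measure N) E" if "E \<in> sets borel" "E \<subseteq> - A" for E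
  proof -
    have "(SUP K\<in>{K. compact K \<and> K \<subseteq> E}. emeasure (rep_measure M) K) =
        (SUP K\<in>{K. compact K \<and> K \<subseteq> E}. emeasure (rep_measure N) K)"
      using that(2) by (intro SUP_cong) (auto intro!: K_eq)
    then show ?thesis
      using M1_posD(4)[OF M A(1)] M1_posD(4)[OF N A(1)] that unfolding tight_def by metis
  qed
  have "(rep_measure M, rep_measure N) \<in> relative_eq A"
    using E_eq M1_posD(2)[OF M A(1)] M1_posD(2)[OF N A(1)]
    by (auto simp: relative_eq_iff[OF A(1)] borel_measures_def)
  then show ?thesis
    using quotient_eqI[OF equiv_relative_eq[OF A(1)]] M1_posD(1)[OF M A(1)] M1_posD(1)[OF N A(1)]
      rep_measure_in[OF A(1)] unfolding relative_borel_measures_def by blast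
qed

lemma (in exhausted_functional) representation:
  obtains M where "M \<in> M1_pos A" "\<And>f. f \<in> Lip A \<Longrightarrow> P f = rel_integral M f"
proof -
  have b: "riesz_measure \<in> borel_measures" by (simp add: borel_measures_def)
  define M where "M = relative_eq A `` {riesz_measure}"
  have M: "M \<in> relative_borel_measures A" "riesz_measure \<in> M"
    unfolding M_def by (rule relative_classI[OF closed b])+
  have em: "emeasure (rep_measure M) E = emeasure riesz_measure E" if "E \<in> sets borel" "E \<subseteq> - A" for E
    using emeasure_rep_measure[OF closed M that] .
  have "tight A M"
    unfolding tight_def
  proof (intro ballI impI)
    fix E :: "'a set" assume E: "E \<in> sets borel" "E \<subseteq> - A"
    have "(SUP K\<in>{K. compact K \<and> K \<subseteq> E}. emeasure riesz_measure K) =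
        (SUP K\<in>{K. compact K \<and> K \<subseteq> E}. emeasure (rep_measure M) K)"
      using E(2) by (intro SUP_cong refl em[symmetric]) (auto simp: compact_imp_closed)
    then show "emeasure (rep_measure M) E = (SUP K\<in>{K. compact K \<and> K \<subseteq> E}. emeasure (rep_measure M) K)"
      using em[OF E] inner_regular[OF E] by simp
  qed
  \<comment> \<open>The distance to \<open>A\<close> is itself in \<open>Lip_pos A\<close>, so its
    integral is the real number that \<open>P\<close> assigns to it.\<close>
  moreover have d: "(\<lambda>x. infdist x A) \<in> Lip_pos A"
    by (intro Lip_posI Lip_infdist) (auto simp: infdist_nonneg)
  then have "(\<integral>\<^sup>+x. ennreal (infdist x A) \<partial>rep_measure M) = ennreal (P (\<lambda>x. infdist x A))"
    using nn_integral_rep_measure[OF closed M, of "\<lambda>x. ennreal (infdist x A)"] measurable_Lip_pos[OF d]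
      nn_integral_riesz_measure[OF d] by simp
  ultimately have MM: "M \<in> M1_pos A" using M by (simp add: M1_pos_def)
  have pos: "P f = rel_integral M f" if f: "f \<in> Lip_pos A" for f
  proof -
    have "rel_integral M f = (\<integral>x. f x \<partial>riesz_measure)"
      using rel_integral_eq[OF closed M measurable_Lip_pos[OF f]] Lip_eq_0[OF Lip_posD(1)[OF f]] by simp
    also have "\<dots> = P f"
      using nn_integral_riesz_measure[OF f] Lip_posD(2)[OF f] measurable_Lip_pos[OF f] nonneg[OF f]
      by (subst integral_eq_nn_integral) auto
    finally show ?thesis by simp
  qed
  have "P f = rel_integral M f" if f: "f \<in> Lip A" for f
  proof -
    let ?u = "\<lambda>x. max (f x) 0" and ?v = "\<lambda>x. max (- f x) 0"
    have uv: "?u \<in> Lip_pos A" "?v \<in> Lip_pos A" using f by (auto intro: Lip_pos_part Lip_uminus)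
    have "f = (\<lambda>x. ?u x - ?v x)" by (auto simp: max_def)
    moreover have "P (\<lambda>x. ?u x - ?v x) = P ?u - P ?v"
      using diff[OF Lip_posD(1)[OF uv(1)] Lip_posD(1)[OF uv(2)]] .
    moreover have "rel_integral M (\<lambda>x. ?u x - ?v x) = rel_integral M ?u - rel_integral M ?v"
      using M1_pos_positive_functional[OF closed nonempty MM] uv
      by (intro linear_functional_diff) (auto simp: positive_functional_def Lip_posD(1))
    ultimately show ?thesis using pos[OF uv(1)] pos[OF uv(2)] by simp
  qed
  then show ?thesis using that MM by blast
qed

section \<open>Disjoint decompositions\<close>

text \<open>For positive functionals the infimum is the Riesz--Kantorovich formula for the meet of
  \<open>P\<close> and \<open>N\<close> at \<open>f\<close>, so the condition is disjointness in the
  order dual.\<close>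

definition disjoint_functionals ::
    "'a::metric_space set \<Rightarrow> (('a \<Rightarrow> real) \<Rightarrow> real) \<Rightarrow> (('a \<Rightarrow> real) \<Rightarrow> real) \<Rightarrow> bool" where
  "disjoint_functionals A P N \<longleftrightarrow> (\<forall>f\<in>Lip_pos A.
     Inf {P g + N h | g h. g \<in> Lip_pos A \<and> h \<in> Lip_pos A \<and> (\<lambda>x. g x + h x) = f} = 0)"

text \<open>Positivity bounds the set below by 0 and the splitting of \<open>f\<close> into
  \<open>f\<close> and 0 makes it nonempty, so the real \<open>Inf\<close> is a genuine
  infimum.\<close>

lemma disjoint_functionals_iff:
  assumes P: "positive_functional A P" and N: "positive_functional A N"
  shows "disjoint_functionals A P N \<longleftrightarrow> (\<forall>f\<in>Lip_pos A. \<forall>e>0. \<exists>g\<in>Lip_pos A. \<exists>h\<in>Lip_pos A.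
    (\<forall>x. g x + h x = f x) \<and> P g + N h < e)"
proof -
  have "Inf S = 0 \<longleftrightarrow> (\<forall>e>0. \<exists>g\<in>Lip_pos A. \<exists>h\<in>Lip_pos A. (\<forall>x. g x + h x = f x) \<and> P g + N h < e)"
    (is "_ \<longleftrightarrow> ?R")
    if S: "S = {P g + N h | g h. g \<in> Lip_pos A \<and> h \<in> Lip_pos A \<and> (\<lambda>x. g x + h x) = f}"
      and f: "f \<in> Lip_pos A" for f S
  proof -
    have pos: "0 \<le> s" if "s \<in> S" for s
      using that P N by (auto simp: S positive_functional_def)
    then have bdd: "bdd_below S" by (auto simp: bdd_below_def)
    have "P f + N (\<lambda>x. 0) \<in> S" unfolding S using f by (intro CollectI exI[of _ f] exI[of _ "\<lambda>x. 0"]) auto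
    then have ne: "S \<noteq> {}" by blast
    have "0 \<le> Inf S" using ne pos by (rule cInf_greatest)
    have "?R \<longleftrightarrow> (\<forall>e>0. \<exists>s\<in>S. s < e)"
      unfolding S by (auto simp: fun_eq_iff Bex_def) blast+
    also have "\<dots> \<longleftrightarrow> (\<forall>e>0. Inf S < e)"
      using cInf_less_iff[OF ne bdd] by simp
    also have "\<dots> \<longleftrightarrow> Inf S = 0"
      using \<open>0 \<le> Inf S\<close> by (metis antisym not_le order_refl less_le)
    finally show ?thesis by simp
  qed
  then show ?thesis unfolding disjoint_functionals_def by blast
qed

text \<open>Disjoint parts are the smallest ones, as for a Jordan decomposition: \<open>P1 g\<close>
  and \<open>N1 h\<close> are small together, and \<open>P1 h\<close> exceeds \<open>P2 h\<close> by
  at most \<open>N1 h\<close>. The second pair need not be disjoint.\<close>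

lemma disjoint_functionals_le:
  assumes P1: "positive_functional A P1" and N1: "positive_functional A N1"
    and P2: "positive_functional A P2" and N2: "positive_functional A N2"
    and eq: "\<And>f. f \<in> Lip A \<Longrightarrow> P1 f - N1 f = P2 f - N2 f"
    and disj: "disjoint_functionals A P1 N1" and f: "f \<in> Lip_pos A"
  shows "P1 f \<le> P2 f"
proof (rule field_le_epsilon)
  fix e :: real assume "0 < e"
  then obtain g h where gh: "g \<in> Lip_pos A" "h \<in> Lip_pos A" "\<And>x. g x + h x = f x" "P1 g + N1 h < e"
    using disj f unfolding disjoint_functionals_iff[OF P1 N1] by blast
  have "P1 (\<lambda>x. g x + h x) = P1 g + P1 h"
    using P1 gh by (intro linear_functional_add) (auto simp: positive_functional_def Lip_posD(1))
  then have "P1 f = P1 g + P1 h" using gh(3) by simp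
  moreover have "P1 h = N1 h + P2 h - N2 h" using eq[of h] gh(2) by (simp add: Lip_posD(1))
  moreover have "0 \<le> N2 h" using N2 gh(2) by (simp add: positive_functional_def)
  moreover have "P2 h \<le> P2 f"
    using gh f Lip_posD(2)[OF gh(1)]
    by (intro positive_functional_mono[OF P2]) (auto simp: Lip_posD(1) gh(3)[symmetric])
  ultimately show "P1 f \<le> P2 f + e" using gh(4) by linarith
qed

text \<open>\<open>P\<close> and \<open>N\<close> are the positive and negative parts of
  \<open>T\<close>. Positivity is the statement that \<open>S\<close> dominates both
  \<open>T\<close> and \<open>- T\<close>; disjointness comes from a nearly optimal \<open>k\<close>
  for the modulus.\<close>

lemma modulus_parts:
  assumes T: "linear_functional A T" "order_bounded A T" and S: "is_modulus A T S"
    and P_def: "\<And>f. P f = (S f + T f) / 2" and N_def: "\<And>f. N f = (S f - T f) / 2"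
  shows "positive_functional A P" "positive_functional A N" "disjoint_functionals A P N"
    "\<And>f. f \<in> Lip_pos A \<Longrightarrow> P f \<le> S f" "\<And>f. f \<in> Lip_pos A \<Longrightarrow> N f \<le> S f"
proof -
  have linS: "linear_functional A S" using S by (simp add: is_modulus_def order_dual_def)
  have pos: "0 \<le> S f - T f" "0 \<le> S f + T f" if "f \<in> Lip_pos A" for f
    using S that by (auto simp: is_modulus_def functional_le_def positive_functional_def)
  show P: "positive_functional A P" and N: "positive_functional A N"
    using linS T(1) pos
    by (auto simp: P_def N_def positive_functional_def linear_functional_def field_simps)
  show "P f \<le> S f" "N f \<le> S f" if "f \<in> Lip_pos A" for f
    using pos[OF that] by (simp_all add: P_def N_def)
  have "\<exists>g\<in>Lip_pos A. \<exists>h\<in>Lip_pos A. (\<forall>x. g x + h x = f x) \<and> P g + N h < e"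
    if f: "f \<in> Lip_pos A" and e: "0 < e" for f and e :: real
  proof -
    obtain k where k: "k \<in> Lip A" "\<And>x. \<bar>k x\<bar> \<le> f x" "S f - e < T k"
      using modulus_approx[OF T S f e] by blast
    \<comment> \<open>If \<open>T k\<close> is close to \<open>S f\<close>, the positive part of
      \<open>T\<close> sees mainly \<open>f + k\<close> and the negative part mainly
      \<open>f - k\<close>. Giving each the other half leaves
      \<open>P g + N h = (S f - T k) / 2\<close>.\<close>
    define g h where "g x = (1/2) * (f x - k x)" and "h x = (1/2) * (f x + k x)" for x
    have fL: "f \<in> Lip A" using f by (rule Lip_posD(1))
    have *: "0 \<le> f x - k x" "0 \<le> f x + k x" for x using k(2)[of x] by (simp_all add: abs_le_iff)
    have g: "g \<in> Lip_pos A" and h: "h \<in> Lip_pos A"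
      unfolding g_def[abs_def] h_def[abs_def] using *
      by (intro Lip_pos_cmult Lip_posI Lip_add Lip_diff fL k(1); simp)+
    have val: "R g = (1/2) * (R f - R k)" "R h = (1/2) * (R f + R k)" if "linear_functional A R" for R
      unfolding g_def[abs_def] h_def[abs_def]
      using linear_functional_cmult[OF that Lip_diff[OF fL k(1)], of "1/2"]
        linear_functional_cmult[OF that Lip_add[OF fL k(1)], of "1/2"]
        linear_functional_diff[OF that fL k(1)] linear_functional_add[OF that fL k(1)]
      by simp_all
    have "P g + N h = (S f - T k) / 2"
      unfolding P_def N_def val[OF linS] val[OF T(1)] by (simp add: field_simps)
    then have "P g + N h < e" using k(3) e by simp
    then show ?thesis using g h by (intro bexI[of _ g] bexI[of _ h]) (auto simp: g_def h_def field_simps)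
  qed
  then show "disjoint_functionals A P N" by (simp add: disjoint_functionals_iff[OF P N])
qed

lemma exhausted_functional_dominated:
  assumes A: "closed A" "A \<noteq> {}" and S: "exhausted_positive A S"
    and P: "positive_functional A P" and le: "\<And>f. f \<in> Lip_pos A \<Longrightarrow> P f \<le> S f"
  shows "exhausted_functional A P"
proof
  fix f :: "'a \<Rightarrow> real" and e :: real
  assume f: "f \<in> Lip_pos A" and e: "0 < e"
  have Sp: "positive_functional A S" using S by (simp add: exhausted_positive_def)
  obtain K where K: "compact K" "K \<subseteq> - A"
      "Sup (S ` {g \<in> Lip_pos A. (\<forall>x\<in>K. g x = 0) \<and> g \<le> f}) < e"
    using S f e unfolding exhausted_positive_def by blast
  have "P g \<le> e" if g: "g \<in> Lip_pos A" "\<forall>x\<in>K. g x = 0" "\<forall>x. g x \<le> f x" for g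
  proof -
    \<comment> \<open>\<open>Sup\<close> on the reals is an upper bound only for bounded sets;
      monotonicity of \<open>S\<close> supplies the bound \<open>S f\<close>.\<close>
    have "bdd_above (S ` {g \<in> Lip_pos A. (\<forall>x\<in>K. g x = 0) \<and> g \<le> f})"
      using f by (intro bdd_aboveI[of _ "S f"])
        (auto simp: le_fun_def Lip_posD(1) intro: positive_functional_mono[OF Sp])
    then have "S g \<le> Sup (S ` {g \<in> Lip_pos A. (\<forall>x\<in>K. g x = 0) \<and> g \<le> f})"
      using g by (intro cSUP_upper) (auto simp: le_fun_def)
    then show ?thesis using le[OF g(1)] K(3) by linarith
  qed
  then show "\<exists>K. compact K \<and> K \<subseteq> - A \<and>
      (\<forall>g\<in>Lip_pos A. (\<forall>x\<in>K. g x = 0) \<longrightarrow> (\<forall>x. g x \<le> f x) \<longrightarrow> P g \<le> e)"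
    using K(1,2) by blast
qed (use A P in auto)

theorem theorem5p24:
  fixes A :: "'a::metric_space set" and T :: "('a \<Rightarrow> real) \<Rightarrow> real"
  assumes "closed A" and "A \<noteq> {}"
    and "locally compact (- A)"
    and "linear_functional A T" and "order_bounded A T"
    and "exhausted_by_compacts A T"
  shows "(\<exists>\<mu>\<in>M1_pos A. \<exists>\<nu>\<in>M1_pos A. \<forall>f\<in>Lip A. T f = rel_integral \<mu> f - rel_integral \<nu> f) \<and>
    (\<exists>!p. case p of (\<mu>, \<nu>) \<Rightarrow>
       \<mu> \<in> M1_pos A \<and> \<nu> \<in> M1_pos A \<and>
       (\<forall>f\<in>Lip A. T f = rel_integral \<mu> f - rel_integral \<nu> f) \<and>
       (\<forall>f\<in>Lip_pos A.
          Inf {rel_integral \<mu> g + rel_integral \<nu> h | g h.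
                 g \<in> Lip_pos A \<and> h \<in> Lip_pos A \<and> (\<lambda>x. g x + h x) = f} = 0))"
proof -
  note A = assms(1,2) and T = assms(4,5)
  obtain S where S: "is_modulus A T S" "exhausted_positive A S"
    using assms(6) by (auto simp: exhausted_by_compacts_def)
  define P N where "P f = (S f + T f) / 2" and "N f = (S f - T f) / 2" for f
  note PN = modulus_parts[OF T S(1) P_def N_def]
  interpret P: exhausted_functional A P
    using A S(2) PN(1,4) by (rule exhausted_functional_dominated)
  interpret N: exhausted_functional A N
    using A S(2) PN(2,5) by (rule exhausted_functional_dominated)
  obtain \<mu> where \<mu>: "\<mu> \<in> M1_pos A" "\<And>f. f \<in> Lip A \<Longrightarrow> P f = rel_integral \<mu> f"
    using P.representation by blast
  obtain \<nu> where \<nu>: "\<nu> \<in> M1_pos A" "\<And>f. f \<in> Lip A \<Longrightarrow> N f = rel_integral \<nu> f"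
    using N.representation by blast
  have rep: "T f = rel_integral \<mu> f - rel_integral \<nu> f" if "f \<in> Lip A" for f
    using \<mu>(2)[OF that] \<nu>(2)[OF that] by (simp add: P_def N_def field_simps)
  note pos = M1_pos_positive_functional[OF A]
  have disj: "disjoint_functionals A (rel_integral \<mu>) (rel_integral \<nu>)"
    using PN(3) \<mu>(2) \<nu>(2)
    unfolding disjoint_functionals_iff[OF PN(1,2)] disjoint_functionals_iff[OF pos[OF \<mu>(1)] pos[OF \<nu>(1)]]
    by (metis Lip_posD(1))
  let ?Q = "\<lambda>p. case p of (\<mu>, \<nu>) \<Rightarrow> \<mu> \<in> M1_pos A \<and> \<nu> \<in> M1_pos A \<and>
      (\<forall>f\<in>Lip A. T f = rel_integral \<mu> f - rel_integral \<nu> f) \<and>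
      disjoint_functionals A (rel_integral \<mu>) (rel_integral \<nu>)"
  have "p = (\<mu>, \<nu>)" if p: "?Q p" for p
  proof -
    obtain \<mu>' \<nu>' where p_eq: "p = (\<mu>', \<nu>')" by (cases p)
    have \<mu>\<nu>': "\<mu>' \<in> M1_pos A" "\<nu>' \<in> M1_pos A" "disjoint_functionals A (rel_integral \<mu>') (rel_integral \<nu>')"
      and rep': "\<And>f. f \<in> Lip A \<Longrightarrow> T f = rel_integral \<mu>' f - rel_integral \<nu>' f"
      using p by (auto simp: p_eq)
    have eq: "rel_integral \<mu> f - rel_integral \<nu> f = rel_integral \<mu>' f - rel_integral \<nu>' f"
      if "f \<in> Lip A" for f using rep[OF that] rep'[OF that] by simp
    \<comment> \<open>Both decompositions are disjoint, so the minimality estimate applies in both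
      directions; equality of the differences then settles the negative parts.\<close>
    have "rel_integral \<mu> f = rel_integral \<mu>' f" if f: "f \<in> Lip_pos A" for f
      using disjoint_functionals_le[OF pos[OF \<mu>(1)] pos[OF \<nu>(1)] pos[OF \<mu>\<nu>'(1)] pos[OF \<mu>\<nu>'(2)] eq disj f]
        disjoint_functionals_le[OF pos[OF \<mu>\<nu>'(1)] pos[OF \<mu>\<nu>'(2)] pos[OF \<mu>(1)] pos[OF \<nu>(1)] eq[symmetric]
          \<mu>\<nu>'(3) f]
      by simp
    moreover from this have "rel_integral \<nu> f = rel_integral \<nu>' f" if "f \<in> Lip_pos A" for f
      using eq[OF Lip_posD(1)[OF that]] that by simp
    ultimately show ?thesis
      using M1_pos_eqI[OF A \<mu>(1) \<mu>\<nu>'(1)] M1_pos_eqI[OF A \<nu>(1) \<mu>\<nu>'(2)] by (simp add: p_eq)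
  qed
  moreover have "?Q (\<mu>, \<nu>)" using \<mu>(1) \<nu>(1) rep disj by simp
  ultimately have "\<exists>!p. ?Q p" by blast
  then show ?thesis
    unfolding disjoint_functionals_def using \<mu>(1) \<nu>(1) rep by blast
qed

end
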